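(* Let $\nu \ge 3$ and let $X = Sp(2\nu,2)$ be the symplectic graph over $\mathbb{F}_2$. Let $X^{O(0,\nu,0)}$, $X^{S}$, $X^{S_4}$ and $X^{S_0\setminus(S\cup T)}$ be the four graphs obtained from $X$ by Godsil–McKay switching, as defined in the context. For a graph $Y$, call the smallest non-zero value taken by the number of common neighbors in $Y$ of $x,y,z$, over all triples of three distinct vertices $x,y,z$ of $Y$, the non-zero minimum number of common neighbors of three distinct vertices of $Y$. Then this number equals: - $2^{2\nu-3}$ for $X$; - $1$ for $X^{S}$; - $2^{\nu-2}$ for $X^{O(0,\nu,0)}$; - $2^{2\nu-5}$ for $X^{S_4}$; - $2^{2\nu-5}-2$ for $X^{S_0\setminus(S\cup T)}$. In particular, for a fixed $\nu$, the five graphs $X$, $X^{O(0,\nu,0)}$, $X^{S}$, $X^{S_4}$, $X^{S_0\setminus(S\cup T)}$ are not isomorphic to each other.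
   Context: Graphs are finite and simple; $N(x)$ is the set of neighbors of $x$. Symplectic graph: let $R=\begin{bmatrix}0&1\\1&0\end{bmatrix}$ and $K=I_\nu\otimes R$ over $\mathbb{F}_2$, where $I_\nu$ is the identity matrix of order $\nu$. $Sp(2\nu,2)$ has vertex set $\mathbb{F}_2^{2\nu}\setminus\{\mathbf 0\}$, with $x,y$ adjacent iff $x^TKy=1$. Godsil–McKay switching: a partition $\{C_1,\dots,C_t,D\}$ of $V(X)$ is a Godsil–McKay partition with Godsil–McKay cell $D$ if (i) for all $i,j\in\{1,\dots,t\}$ any two vertices of $C_i$ have the same number of neighbors in $C_j$, and (ii) for every $x\in D$ and every $i\in\{1,\dots,t\}$, $|N(x)\cap C_i|\in\{0,\frac12|C_i|,|C_i|\}$. The switched graph with respect to this partition and cell is obtained from $X$ by interchanging adjacency and non-adjacency between $x\in D$ and the vertices of $C_i$ whenever $|N(x)\cap C_i|=\frac12|C_i|$. First partition: write $x\in\mathbb{F}_2^{2\nu}$ as $\nu$ consecutive blocks $x_1,\dots,x_\nu\in\mathbb{F}_2^2$; the weight of a vector is its number of non-zero components. For $i+j+k=\nu$, let $O(i,j,k)$ be the set of $x\in\mathbb{F}_2^{2\nu}$ with exactly $i$ blocks of weight 2, $j$ blocks of weight 1 and $k$ blocks of weight 0. The sets $O(i,j,k)$ with $i+j+k=\nu$, $(i,j,k)\ne(0,0,\nu)$, partition $V(X)$ (they are the orbits of the group of automorphisms of $X$ that fix the set of standard basis vectors), and this is a Godsil–McKay partition with cell $O(0,\nu,0)$. $X^{O(0,\nu,0)}$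 is the corresponding switched graph. Second partition: let $S=\{v_1,v_2,v_3,v_4\}$ be a 4-subset of $V(X)$, where $v_1,v_2,v_3$ are linearly independent, $v_i^TKv_j=0$ for all $i,j\in\{1,2,3\}$, and $v_4=v_1+v_2+v_3$. Let $S_i=\{x\in V(X) : \#\{j\in\{1,2,3,4\} : x^TKv_j=1\}=i\}$ for $i=0,2,4$; then $V(X)=S_0\sqcup S_2\sqcup S_4$. Let $T=\{v_1+v_2,v_2+v_3,v_3+v_1\}$; then $S,T\subset S_0$. The partition $\{S,T,S_0\setminus(S\cup T),S_2,S_4\}$ (the orbit partition of the group of automorphisms of $X$ fixing $S$ setwise) is a Godsil–McKay partition with cell $D$ for each of $D=S$, $D=S_0\setminus(S\cup T)$, $D=S_4$; the corresponding switched graphs are denoted $X^S$, $X^{S_0\setminus(S\cup T)}$, $X^{S_4}$.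
   Formalization: For ν=3, S_0\(S∪T) is empty and X^{O(0,ν,0)}, X^{S_4} are isomorphic; so the value for X^{S_0\(S∪T)}, its non-isomorphism to the others, and the non-isomorphism of X^{O(0,ν,0)} and X^{S_4} are stated only for ν≥4. *)

theory Defs
  imports
    "HOL-Analysis.Cartesian_Space"
    "HOL-Library.Z2"
    "HOL-Library.Disjoint_Sets"
    "Graph_Theory.Pair_Digraph"
    "Graph_Theory.Digraph_Isomorphism"
begin

section \<open>Graphs\<close>

text \<open>
  A finite simple graph is a \<^typ>\<open>'a pair_pre_digraph\<close> satisfying the library locale
  \<^locale>\<open>pair_graph\<close>: finite, loopfree, with a symmetric arc relation and no parallel arcs.
\<close>

definition neighbors :: "'a pair_pre_digraph \<Rightarrow> 'a \<Rightarrow> 'a set" where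
  "neighbors G x = {y \<in> pverts G. (x, y) \<in> parcs G}"

definition graph_iso :: "'a pair_pre_digraph \<Rightarrow> 'b pair_pre_digraph \<Rightarrow> bool" where
  "graph_iso G H \<longleftrightarrow> digraph_iso (with_proj G) (with_proj H)"

lemma graph_iso_iff_bij:
  assumes "pair_wf_digraph G" "pair_wf_digraph H"
  shows "graph_iso G H \<longleftrightarrow> (\<exists>f. bij_betw f (pverts G) (pverts H) \<and>
    (\<forall>x\<in>pverts G. \<forall>y\<in>pverts G. (x, y) \<in> parcs G \<longleftrightarrow> (f x, f y) \<in> parcs H))"
proof
  assume "graph_iso G H"
  then obtain f where f: "pre_digraph.digraph_isomorphism (with_proj G) f"
    and H: "with_proj H = app_iso f (with_proj G)"
    by (auto simp: graph_iso_def digraph_iso_def)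
  interpret G: pair_wf_digraph G by fact
  let ?v = "iso_verts f" and ?a = "iso_arcs f"
  have hd: "iso_tail f = fst" "iso_head f = snd"
    using arg_cong[OF H, of tail] arg_cong[OF H, of head] by simp_all
  have V: "pverts H = ?v ` pverts G" and A: "parcs H = ?a ` parcs G"
    using arg_cong[OF H, of verts] arg_cong[OF H, of arcs] by simp_all
  have inj: "inj_on ?v (pverts G)"
    using f by (simp add: pre_digraph.digraph_isomorphism_def)
  have a: "?a e = (?v (fst e), ?v (snd e))" if "e \<in> parcs G" for e
    using f that by (auto simp: pre_digraph.digraph_isomorphism_def hd prod_eq_iff)
  have "(x, y) \<in> parcs G \<longleftrightarrow> (?v x, ?v y) \<in> parcs H" if "x \<in> pverts G" "y \<in> pverts G" for x y
  proof
    assume "(x, y) \<in> parcs G"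
    from a[OF this] imageI[OF this, of ?a] show "(?v x, ?v y) \<in> parcs H" by (simp add: A)
  next
    assume "(?v x, ?v y) \<in> parcs H"
    then obtain e where e: "e \<in> parcs G" "?v (fst e) = ?v x" "?v (snd e) = ?v y"
      using a by (auto simp: A)
    have "fst e = x" "snd e = y"
      using e inj that G.arc_fst_in_verts G.arc_snd_in_verts by (auto dest: inj_onD)
    with e show "(x, y) \<in> parcs G" by (cases e) auto
  qed
  with inj V show "\<exists>f. bij_betw f (pverts G) (pverts H) \<and>
    (\<forall>x\<in>pverts G. \<forall>y\<in>pverts G. (x, y) \<in> parcs G \<longleftrightarrow> (f x, f y) \<in> parcs H)"
    by (intro exI[of _ ?v]) (auto simp: bij_betw_def)
next
  assume "\<exists>f. bij_betw f (pverts G) (pverts H) \<and>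
    (\<forall>x\<in>pverts G. \<forall>y\<in>pverts G. (x, y) \<in> parcs G \<longleftrightarrow> (f x, f y) \<in> parcs H)"
  then obtain f where f: "bij_betw f (pverts G) (pverts H)"
    "\<And>x y. x \<in> pverts G \<Longrightarrow> y \<in> pverts G \<Longrightarrow> (x, y) \<in> parcs G \<longleftrightarrow> (f x, f y) \<in> parcs H"
    by blast
  interpret G: pair_wf_digraph G by fact
  interpret H: pair_wf_digraph H by fact
  let ?h = "\<lparr> iso_verts = f, iso_arcs = map_prod f f, iso_head = snd, iso_tail = fst \<rparr>"
  have inj: "inj_on f (pverts G)" and V: "f ` pverts G = pverts H"
    using f(1) by (auto simp: bij_betw_def)
  have sub: "parcs G \<subseteq> pverts G \<times> pverts G"
    by (auto dest: G.in_arcsD1 G.in_arcsD2)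
  have A: "map_prod f f ` parcs G = parcs H"
  proof (intro equalityI subsetI)
    fix e assume "e \<in> map_prod f f ` parcs G"
    then show "e \<in> parcs H" using f(2) sub by auto
  next
    fix e assume e: "e \<in> parcs H"
    then have "fst e \<in> f ` pverts G" "snd e \<in> f ` pverts G"
      using H.arc_fst_in_verts H.arc_snd_in_verts V by auto
    then obtain x y where "x \<in> pverts G" "y \<in> pverts G" "e = (f x, f y)"
      by (cases e) auto
    with e f(2) show "e \<in> map_prod f f ` parcs G" by (force intro: rev_image_eqI[of "(x, y)"])
  qed
  have "inj_on (map_prod f f) (parcs G)"
    using map_prod_inj_on[OF inj inj] sub by (rule inj_on_subset)
  then have "pre_digraph.digraph_isomorphism (with_proj G) ?h"
    using inj by (auto simp: pre_digraph.digraph_isomorphism_def G.wf_digraph_axioms)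
  moreover have "with_proj H = app_iso ?h (with_proj G)"
    by (simp add: app_iso_def with_proj_def V A)
  ultimately show "graph_iso G H"
    by (auto simp: graph_iso_def digraph_iso_def)
qed

text \<open>
  If every three distinct vertices have no common neighbor, this is \<^term>\<open>Min {}\<close>, about which
  nothing is provable; hence an equation for this number includes its existence.
\<close>

definition nonzero_min_common_neighbors :: "'a pair_pre_digraph \<Rightarrow> nat" where
  "nonzero_min_common_neighbors G =
     Min ({card (neighbors G x \<inter> neighbors G y \<inter> neighbors G z) | x y z.
             x \<in> pverts G \<and> y \<in> pverts G \<and> z \<in> pverts G \<and> x \<noteq> y \<and> y \<noteq> z \<and> x \<noteq> z} - {0})"


section \<open>Godsil--McKay switching\<close>

definition gm_partition :: "'a pair_pre_digraph \<Rightarrow> 'a set set \<Rightarrow> 'a set \<Rightarrow> bool" where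
  "gm_partition G P D \<longleftrightarrow> partition_on (pverts G) P \<and> D \<in> P \<and>
     (\<forall>A\<in>P - {D}. \<forall>C\<in>P - {D}. \<forall>x\<in>A. \<forall>y\<in>A.
        card (neighbors G x \<inter> C) = card (neighbors G y \<inter> C)) \<and>
     (\<forall>x\<in>D. \<forall>C\<in>P - {D}.
        real (card (neighbors G x \<inter> C)) \<in> {0, 1 / 2 * real (card C), real (card C)})"

text \<open>
  The following operation is defined for any family \<open>P\<close>; it is Godsil--McKay switching if
  \<open>gm_partition G P D\<close> holds. Under that condition at most one of \<open>gm_flip G P D x y\<close> and
  \<open>gm_flip G P D y x\<close> holds, as \<open>D\<close> is disjoint from the other cells.
\<close>

definition gm_flip :: "'a pair_pre_digraph \<Rightarrow> 'a set set \<Rightarrow> 'a set \<Rightarrow> 'a \<Rightarrow> 'a \<Rightarrow> bool" where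
  "gm_flip G P D x y \<longleftrightarrow>
     x \<in> D \<and> (\<exists>C\<in>P - {D}. y \<in> C \<and> real (card (neighbors G x \<inter> C)) = 1 / 2 * real (card C))"

definition gm_switch :: "'a pair_pre_digraph \<Rightarrow> 'a set set \<Rightarrow> 'a set \<Rightarrow> 'a pair_pre_digraph" where
  "gm_switch G P D =
     \<lparr> pverts = pverts G,
       parcs = {(x, y). x \<in> pverts G \<and> y \<in> pverts G \<and>
                  (if gm_flip G P D x y \<or> gm_flip G P D y x
                   then (x, y) \<notin> parcs G else (x, y) \<in> parcs G)} \<rparr>"

lemma pair_graph_gm_switch:
  assumes "pair_graph G" and "\<And>C. C \<in> P - {D} \<Longrightarrow> C \<inter> D = {}"
  shows "pair_graph (gm_switch G P D)"
proof -
  interpret G: pair_graph G by fact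
  have sym: "(x, y) \<in> parcs G \<longleftrightarrow> (y, x) \<in> parcs G" for x y
    using G.pair_sym_arcs by (auto simp: symmetric_def dest: symD)
  have loop: "(x, x) \<notin> parcs G" for x
    using G.pair_no_loops by force
  have flip: "\<not> gm_flip G P D x x" for x
    using assms(2) by (auto simp: gm_flip_def)
  have fin: "finite (pverts G)" by (rule G.pair_finite_verts)
  show ?thesis
  proof unfold_locales
    show "finite (parcs (gm_switch G P D))"
      by (rule finite_subset[of _ "pverts G \<times> pverts G"]) (auto simp: gm_switch_def fin)
    have "sym (parcs (gm_switch G P D))"
      by (rule symI) (use sym in \<open>auto simp: gm_switch_def split: if_splits\<close>)
    then show "symmetric (gm_switch G P D)" by (simp add: symmetric_def)
  qed (auto simp: gm_switch_def fin flip loop)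
qed

corollary pair_graph_gm_switch_partition:
  assumes "pair_graph G" and "gm_partition G P D"
  shows "pair_graph (gm_switch G P D)"
proof (rule pair_graph_gm_switch[OF assms(1)])
  show "C \<inter> D = {}" if "C \<in> P - {D}" for C
  proof (rule disjointD)
    show "disjoint P" "D \<in> P"
      using assms(2) by (auto simp: gm_partition_def dest: partition_onD2)
  qed (use that in auto)
qed


section \<open>The symplectic graph\<close>

instance bit :: finite
proof
  show "finite (UNIV :: bit set)"
    by (rule finite_subset[of _ "{0, 1}"]) auto
qed

text \<open>
  \<open>\<nu>\<close> is \<^term>\<open>CARD('n)\<close>. The coordinates of \<open>\<F>\<^sub>2\<^bsup>2\<nu>\<^esup>\<close> are indexed by \<^typ>\<open>'n \<times> 2\<close>, so that the
  coordinates \<open>(l, 1)\<close> and \<open>(l, 2)\<close> form the block with index \<open>l\<close>.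
\<close>

type_synonym 'n symp_vec = "bit ^ ('n \<times> 2)"

definition kronecker_product ::
    "'a::times ^ 'n ^ 'm \<Rightarrow> 'a ^ 'q ^ 'p \<Rightarrow> 'a ^ ('n \<times> 'q) ^ ('m \<times> 'p)" where
  "kronecker_product A B = (\<chi> r c. A $ fst r $ fst c * B $ snd r $ snd c)"

definition R_mat :: "bit ^ 2 ^ 2" where
  "R_mat = vector [vector [0, 1], vector [1, 0]]"

definition K_mat :: "bit ^ ('n::finite \<times> 2) ^ ('n \<times> 2)" where
  "K_mat = kronecker_product (mat 1) R_mat"

definition symp_form :: "'n::finite symp_vec \<Rightarrow> 'n symp_vec \<Rightarrow> bit" where
  "symp_form x y = scalar_product x (K_mat *v y)"

definition Sp :: "'n::finite symp_vec pair_pre_digraph" where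
  "Sp = \<lparr> pverts = UNIV - {0}, parcs = {(x, y). x \<noteq> 0 \<and> y \<noteq> 0 \<and> symp_form x y = 1} \<rparr>"

lemma symp_form_eq:
  "symp_form x y = (\<Sum>l\<in>UNIV. x $ (l, 1) * y $ (l, 2) + x $ (l, 2) * y $ (l, 1))"
proof -
  have K: "K_mat $ (l, a) $ (m, b) = (if l = m \<and> a \<noteq> b then 1 else 0)"
    for l m :: 'a and a b :: 2
    using exhaust_2[of a] exhaust_2[of b]
    by (auto simp: K_mat_def kronecker_product_def mat_def R_mat_def)
  have *: "(K_mat *v y) $ (l, a) = (\<Sum>b\<in>UNIV. if a \<noteq> b then y $ (l, b) else 0)" for l a
  proof -
    have "(K_mat *v y) $ (l, a) = (\<Sum>m\<in>UNIV. \<Sum>b\<in>UNIV. K_mat $ (l, a) $ (m, b) * y $ (m, b))"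
      by (simp only: matrix_vector_mult_def vec_lambda_beta sum.cartesian_product UNIV_Times_UNIV
          split_def prod.collapse)
    also have "\<dots> = (\<Sum>m\<in>UNIV. if l = m then \<Sum>b\<in>UNIV. if a \<noteq> b then y $ (m, b) else 0 else 0)"
    proof (rule sum.cong[OF refl])
      fix m
      have "K_mat $ (l, a) $ (m, b) * y $ (m, b) =
          (if l = m then if a \<noteq> b then y $ (m, b) else 0 else 0)" for b
        by (simp add: K)
      then show "(\<Sum>b\<in>UNIV. K_mat $ (l, a) $ (m, b) * y $ (m, b)) =
          (if l = m then \<Sum>b\<in>UNIV. if a \<noteq> b then y $ (m, b) else 0 else 0)"
        by (cases "l = m") (simp_all only: if_True if_False sum.neutral_const simp_thms)
    qed
    finally show ?thesis by (simp only: sum.delta'[OF finite] UNIV_I if_True)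
  qed
  have "symp_form x y = (\<Sum>l\<in>UNIV. \<Sum>a\<in>UNIV. x $ (l, a) * (K_mat *v y) $ (l, a))"
    by (simp only: symp_form_def scalar_product_def sum.cartesian_product UNIV_Times_UNIV
        split_def prod.collapse)
  then show ?thesis by (simp add: * sum_2)
qed

lemma pair_graph_Sp: "pair_graph (Sp :: 'n::finite symp_vec pair_pre_digraph)"
proof -
  have "a * b + b * a = 0" for a b :: bit
    by (cases a; cases b) simp_all
  then have alt: "symp_form x x = 0" for x :: "'n symp_vec"
    unfolding symp_form_eq by (intro sum.neutral) blast
  have sym: "symp_form x y = symp_form y x" for x y :: "'n symp_vec"
    unfolding symp_form_eq by (rule sum.cong) (simp_all only: ac_simps)
  have fin: "finite A" for A :: "'n symp_vec set" by simp
  show ?thesis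
  proof unfold_locales
    show "finite (parcs (Sp :: 'n symp_vec pair_pre_digraph))"
      by (rule finite_subset[of _ "UNIV \<times> UNIV"]) (auto simp: fin)
    have "sym (parcs (Sp :: 'n symp_vec pair_pre_digraph))"
      by (rule symI) (use sym in \<open>auto simp: Sp_def\<close>)
    then show "symmetric (Sp :: 'n symp_vec pair_pre_digraph)" by (simp add: symmetric_def)
  qed (auto simp: Sp_def alt)
qed


section \<open>The partition into the sets \<open>O(i,j,k)\<close>\<close>

definition block :: "'n::finite symp_vec \<Rightarrow> 'n \<Rightarrow> bit ^ 2" where
  "block x l = (\<chi> a. x $ (l, a))"

definition weight :: "bit ^ 'm \<Rightarrow> nat" where
  "weight v = card {a. v $ a \<noteq> 0}"

definition O_set :: "nat \<Rightarrow> nat \<Rightarrow> nat \<Rightarrow> 'n::finite symp_vec set" where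
  "O_set i j k = {x. card {l. weight (block x l) = 2} = i \<and>
                     card {l. weight (block x l) = 1} = j \<and>
                     card {l. weight (block x l) = 0} = k}"

definition O_partition :: "'n::finite symp_vec set set" where
  "O_partition = {O_set i j k | i j k.
     i + j + k = CARD('n) \<and> (i, j, k) \<noteq> (0, 0, CARD('n))}"


section \<open>The partition defined by four vertices\<close>

definition S_level :: "'n::finite symp_vec set \<Rightarrow> nat \<Rightarrow> 'n symp_vec set" where
  "S_level S i = {x \<in> pverts Sp. card {v \<in> S. symp_form x v = 1} = i}"

text \<open>
  For \<open>\<nu> = 3\<close> the set \<^term>\<open>S_level S 0 - (S \<union> T)\<close> is empty. As a member of the family
  it is then irrelevant for \<^const>\<open>gm_switch\<close>, but it is not a cell one can switch with respect to.
\<close>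

definition S_partition ::
    "'n::finite symp_vec set \<Rightarrow> 'n symp_vec set \<Rightarrow> 'n symp_vec set set" where
  "S_partition S T = {S, T, S_level S 0 - (S \<union> T), S_level S 2, S_level S 4}"

end

theory Submission
  imports Defs
begin

text \<open>
  Write \<open>V\<close> for the space of dimension \<open>2\<nu>\<close> and \<open>\<langle>x, y\<rangle>\<close> for the symplectic form. The form is
  non-degenerate, so every condition \<open>\<langle>u, w\<rangle> = c\<close> on \<open>w\<close> with \<open>u\<close> outside the span of the vectors already
  used halves the set of solutions. In \<open>Sp(2\<nu>, 2)\<close> three independent vertices therefore have
  \<open>2\<^bsup>2\<nu>-3\<^esup>\<close> common neighbors, while \<open>x\<close>, \<open>y\<close>, \<open>x + y\<close> have none, since \<open>1 + 1 \<noteq> 1\<close>.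

  Let \<open>W\<close> be an isotropic subspace of dimension \<open>k\<close> and let \<open>D\<close> be a union of cosets of \<open>W\<close> disjoint
  from \<open>W\<close>. Three of the switched graphs arise by interchanging adjacency and non-adjacency between
  \<open>D\<close> and \<open>R = V - (W \<union> D)\<close>. For \<open>w \<in> D\<close>, being a neighbor of \<open>x\<close> then means
  \<open>\<langle>x, w\<rangle> = 1 + [x \<in> R]\<close>, for \<open>w \<in> R\<close> it means \<open>\<langle>x, w\<rangle> = 1 + [x \<in> D]\<close>, and for \<open>w \<in> W\<close> nothing
  changes; here \<open>[P]\<close> is one if \<open>P\<close> holds and zero otherwise. Dependent triples now
  acquire common neighbors: adding up the three conditions shows that those in \<open>D\<close> exist only if an odd number of \<open>x\<close>, \<open>y\<close>, \<open>x + y\<close> lies in \<open>R\<close>, and those in \<open>R\<close> only if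
  an odd number lies in \<open>D\<close>; in both cases \<open>x\<close> and \<open>y\<close> turn out to be independent modulo \<open>W\<close>
  (\<open>common_D_dependent\<close>, \<open>common_R_dependent\<close>). Triples of the first kind give the minimum. Triples of the
  second kind and independent triples have more common neighbors: the equations that are valid on \<open>R\<close>
  define an affine subspace of codimension two or three, and what it loses in \<open>W \<union> D\<close> is either small
  or made up by other common neighbors there.

  If \<open>D\<close> is a single coset of the orthogonal space of \<open>W\<close>, the minimum is the number \<open>2\<^bsup>2\<nu>-k-2\<^esup>\<close> of
  \<open>w \<in> D\<close> orthogonal to two vectors independent modulo \<open>W\<close>
  (\<open>nonzero_min_common_neighbors_single_coset\<close>). This covers \<open>S\<^sub>4\<close>, where \<open>W\<close> is spanned by \<open>v\<^sub>1, v\<^sub>2, v\<^sub>3\<close>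
  and \<open>k = 3\<close>, and \<open>O(0,\<nu>,0)\<close>, where \<open>W\<close> consists of the vectors without blocks of weight one and
  \<open>k = \<nu>\<close>. For \<open>D = S\<^sub>0 - (S \<union> T)\<close>, which is the orthogonal space of \<open>W\<close> without \<open>W\<close> itself, the two
  vectors of \<open>W\<close> that satisfy the conditions have to be subtracted
  (\<open>nonzero_min_common_neighbors_perp\<close>). For \<open>D = S\<close> a triple with exactly one common neighbor can be
  written down (\<open>nonzero_min_S\<close>).

  What switching does to each cell is found by exhibiting, on a cell of which \<open>x\<close> sees one half, an
  involution that toggles adjacency to \<open>x\<close>. Finally the number is invariant under isomorphism, and the
  values are distinct, except that for \<open>\<nu> = 3\<close> those of \<open>S\<^sub>4\<close> and \<open>O(0,\<nu>,0)\<close> agree.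
\<close>

section \<open>The symplectic form over the field with two elements\<close>

lemma vec_add_self [simp]: "x + x = 0" for x :: "bit ^ 'm"
  by (simp add: vec_eq_iff)

lemma vec_add_eq_0_iff [simp]: "x + y = 0 \<longleftrightarrow> x = y" for x y :: "bit ^ 'm"
  by (metis add_left_cancel vec_add_self)

lemma vec_add_cancel [simp]: "x + (x + y) = y" for x y :: "bit ^ 'm"
  by (simp flip: add.assoc)

lemma vec_add_cancel_right [simp]: "x + y + y = x" "y + (x + y) = x" for x y :: "bit ^ 'm"
  by (simp_all add: add.assoc add.left_commute[of y])

lemma vec_diff_eq_add: "x - y = x + y" for x y :: "bit ^ 'm"
  by (metis add_diff_cancel_right' group_cancel.sub1 vec_add_self diff_0_right)

text \<open>Adjacency is treated as a Boolean-valued form, so that addition of bits becomes inequality of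
  truth values and parity arguments become propositional.\<close>

definition adj :: "'n::finite symp_vec \<Rightarrow> 'n symp_vec \<Rightarrow> bool" where
  "adj x y \<longleftrightarrow> symp_form x y = 1"

lemma adj_sym: "adj x y \<longleftrightarrow> adj y x"
proof -
  have "symp_form x y = symp_form y x"
    unfolding symp_form_eq by (rule sum.cong) (simp_all only: ac_simps)
  then show ?thesis by (simp add: adj_def)
qed

lemma adj_add_left [simp]: "adj (x + y) z \<longleftrightarrow> adj x z \<noteq> adj y z"
proof -
  have "symp_form (x + y) z = symp_form x z + symp_form y z"
    unfolding symp_form_eq sum.distrib[symmetric]
    by (rule sum.cong) (simp_all only: vector_add_component distrib_left distrib_right ac_simps)
  then show ?thesis
    by (cases "symp_form x z"; cases "symp_form y z") (simp_all add: adj_def)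
qed

lemma adj_add_right [simp]: "adj z (x + y) \<longleftrightarrow> adj z x \<noteq> adj z y"
  using adj_add_left[of x y z] by (simp only: adj_sym[of z])

lemma adj_zero [simp]: "\<not> adj 0 x" "\<not> adj x 0"
  using adj_add_left[of 0 0 x] adj_add_right[of x 0 0] by simp_all

lemma adj_axis:
  "adj x (axis (l, 1) 1) \<longleftrightarrow> x $ (l, 2) = 1"
  "adj x (axis (l, 2) 1) \<longleftrightarrow> x $ (l, 1) = 1"
proof -
  have "symp_form x (axis (l, 1) 1) = (\<Sum>m\<in>UNIV. if m = l then x $ (m, 2) else 0)"
    unfolding symp_form_eq by (rule sum.cong) (auto simp: axis_def)
  then show "adj x (axis (l, 1) 1) \<longleftrightarrow> x $ (l, 2) = 1" by (simp add: adj_def)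
  have "symp_form x (axis (l, 2) 1) = (\<Sum>m\<in>UNIV. if m = l then x $ (m, 1) else 0)"
    unfolding symp_form_eq by (rule sum.cong) (auto simp: axis_def)
  then show "adj x (axis (l, 2) 1) \<longleftrightarrow> x $ (l, 1) = 1" by (simp add: adj_def)
qed

lemma adj_nondegenerate: "x \<noteq> 0 \<Longrightarrow> \<exists>p. adj x p"
proof -
  assume "x \<noteq> 0"
  then obtain l a where "x $ (l, a) = 1" by (auto simp: vec_eq_iff)
  then have "adj x (axis (l, 2) 1) \<or> adj x (axis (l, 1) 1)"
    using exhaust_2[of a] by (auto simp: adj_axis)
  then show ?thesis by blast
qed

lemma span_insert_bit:
  "x \<in> vec.span (insert a S) \<longleftrightarrow> x \<in> vec.span S \<or> x + a \<in> vec.span S" for a :: "bit ^ 'm"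
proof -
  have "(\<exists>k. P k) \<longleftrightarrow> P 0 \<or> P 1" for P :: "bit \<Rightarrow> bool"
    by (metis bit.exhaust)
  then show ?thesis by (simp add: vec.span_breakdown_eq vec_diff_eq_add)
qed

lemma span_add_left_iff:
  "x \<in> vec.span S \<Longrightarrow> x + y \<in> vec.span S \<longleftrightarrow> y \<in> vec.span S" for x y :: "bit ^ 'm"
  by (metis vec.span_add vec_add_cancel)

text \<open>This is \<open>(U\<^sup>\<bottom>)\<^sup>\<bottom> = span U\<close> in the form in which it is used below: a vector outside the span of
  \<open>U\<close> imposes a condition that is independent of those imposed by \<open>U\<close>.\<close>

lemma separating_vector:
  fixes U :: "'n::finite symp_vec set"
  assumes "u \<notin> vec.span U"
  shows "\<exists>p. (\<forall>v\<in>U. \<not> adj v p) \<and> adj u p"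
proof -
  have "finite U" by simp
  then show ?thesis using assms
  proof (induction U arbitrary: u)
    case empty
    then show ?case using adj_nondegenerate by simp
  next
    case (insert v U)
    then have "u \<notin> vec.span U" "u + v \<notin> vec.span U" by (simp_all add: span_insert_bit)
    then obtain p q where p: "\<forall>v\<in>U. \<not> adj v p" "adj u p"
      and q: "\<forall>v\<in>U. \<not> adj v q" "adj (u + v) q"
      using insert.IH by meson
    (* among p, q and p + q there is one that separates u from v as well *)
    consider "\<not> adj v p" | "\<not> adj v q" "adj u q" | "\<not> adj v (p + q)" "adj u (p + q)"
      using p q by auto
    then show ?case
    proof cases
      case 1
      with p show ?thesis by blast
    next
      case 2
      with q show ?thesis by blast
    next
      case 3
      with p q show ?thesis by (intro exI[of _ "p + q"]) simp
    qed
  qed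
qed

text \<open>All statements that a condition holds on exactly one half of a set come from this lemma, with a
  translation or a blockwise change as the involution.\<close>

lemma card_toggling_involution:
  fixes A :: "'a::finite set" and P :: "'a \<Rightarrow> bool"
  assumes "\<And>w. w \<in> A \<Longrightarrow> g w \<in> A" "\<And>w. w \<in> A \<Longrightarrow> g (g w) = w"
    and "\<And>w. w \<in> A \<Longrightarrow> P (g w) \<noteq> P w"
  shows "2 * card {w \<in> A. P w = c} = card A"
proof -
  have P: "w \<in> A \<Longrightarrow> P (g w) \<longleftrightarrow> \<not> P w" for w using assms(3) by blast
  have "card {w \<in> A. P w = c} = card {w \<in> A. P w \<noteq> c}"
  proof (rule bij_betw_same_card[of g], rule bij_betw_byWitness[of _ g])
    show "g ` {w \<in> A. P w = c} \<subseteq> {w \<in> A. P w \<noteq> c}"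
      by (auto simp: assms(1) P)
    show "g ` {w \<in> A. P w \<noteq> c} \<subseteq> {w \<in> A. P w = c}"
      by (auto simp: assms(1) P)
  qed (use assms(2) in simp_all)
  moreover have "card A = card {w \<in> A. P w = c} + card {w \<in> A. P w \<noteq> c}"
    by (subst card_Un_disjoint[symmetric]) (auto intro: arg_cong[of _ _ card])
  ultimately show ?thesis by simp
qed

text \<open>The affine subspace cut out by one equation for each vector of \<open>U\<close>; if the equations are homogeneous,
  this is the orthogonal space of \<open>U\<close>.\<close>

definition sols :: "'n::finite symp_vec set \<Rightarrow> ('n symp_vec \<Rightarrow> bool) \<Rightarrow> 'n symp_vec set" where
  "sols U c = {w. \<forall>u\<in>U. adj u w = c u}"

lemma sols_empty [simp]: "sols {} c = UNIV"
  by (simp add: sols_def)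

lemma card_sols_insert:
  assumes "u \<notin> vec.span U"
  shows "2 * card {w \<in> sols U c. adj u w = a} = card (sols U c)"
proof -
  obtain p where "\<forall>v\<in>U. \<not> adj v p" "adj u p" using separating_vector[OF assms] by blast
  then show ?thesis
    by (intro card_toggling_involution[of _ "\<lambda>w. w + p"]) (auto simp: sols_def add.assoc)
qed

lemma card_sols:
  fixes U :: "'n::finite symp_vec set"
  assumes "vec.independent U"
  shows "2 ^ card U * card (sols U c) = 2 ^ (2 * CARD('n))"
proof -
  have "finite U" by simp
  then show ?thesis using assms
  proof (induction U)
    case empty
    have "(UNIV :: bit set) = {0, 1}" by auto
    then have "CARD(bit) = card {0, 1 :: bit}" by (rule arg_cong)
    then have "CARD(bit) = 2" by simp
    then show ?case by (simp add: mult.commute)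
  next
    case (insert u U)
    then have "u \<notin> vec.span U" "vec.independent U" by (simp_all add: vec.independent_insert)
    moreover have "sols (insert u U) c = {w \<in> sols U c. adj u w = c u}"
      by (auto simp: sols_def)
    ultimately have "2 * card (sols (insert u U) c) = card (sols U c)"
      using card_sols_insert[of u U c "c u"] by simp
    from arg_cong[OF this, of "(*) (2 ^ card U)"]
    have "2 ^ card (insert u U) * card (sols (insert u U) c) = 2 ^ card U * card (sols U c)"
      using insert.hyps by (simp add: mult.assoc[symmetric])
    then show ?case using insert.IH \<open>vec.independent U\<close> by simp
  qed
qed

lemma sols_nonempty: "vec.independent U \<Longrightarrow> \<exists>w. w \<in> sols U c"
  using card_sols[of U c] by (cases "sols U c = {}") auto

lemma card_span_independent:
  fixes U :: "'n::finite symp_vec set"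
  assumes "vec.independent U"
  shows "card (vec.span U) = 2 ^ card U"
proof -
  have "finite U" by simp
  then show ?thesis using assms
  proof (induction U)
    case (insert u U)
    then have u: "u \<notin> vec.span U" and U: "vec.independent U"
      by (simp_all add: vec.independent_insert)
    have "vec.span (insert u U) = vec.span U \<union> (+) u ` vec.span U"
    proof (rule set_eqI)
      fix x
      have "x \<in> (+) u ` vec.span U" if "x + u \<in> vec.span U"
        by (rule image_eqI[OF _ that]) simp
      then show "x \<in> vec.span (insert u U) \<longleftrightarrow> x \<in> vec.span U \<union> (+) u ` vec.span U"
        by (auto simp: span_insert_bit add.commute[of u] add.assoc)
    qed
    moreover have "vec.span U \<inter> (+) u ` vec.span U = {}"
      using u by (auto simp: add.commute[of u] span_add_left_iff)
    moreover have "card ((+) u ` vec.span U) = card (vec.span U)"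
      by (rule card_image) simp
    ultimately show ?case using insert U by (simp add: card_Un_disjoint)
  qed simp
qed

section \<open>Isotropic subspaces\<close>

lemma not_adj_span:
  assumes "x \<in> vec.span U" "\<And>u. u \<in> U \<Longrightarrow> \<not> adj u y"
  shows "\<not> adj x y"
  using assms(1)
proof (rule vec.span_induct)
  have "k *s x = (if k = 0 then 0 else x)" for k :: bit and x :: "'a symp_vec"
    by (cases k) simp_all
  then show "vec.subspace {x. \<not> adj x y}" by (auto simp: vec.subspace_def)
qed (use assms(2) in simp)

locale isotropic =
  fixes U :: "'n::finite symp_vec set"
  assumes independent: "vec.independent U"
    and isotropic: "\<And>u v. u \<in> U \<Longrightarrow> v \<in> U \<Longrightarrow> \<not> adj u v"
begin

abbreviation W where "W \<equiv> vec.span U"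

abbreviation W_perp where "W_perp \<equiv> sols U (\<lambda>_. False)"

lemma W_subset_perp: "W \<subseteq> W_perp"
  using not_adj_span[of _ U] isotropic by (auto simp: sols_def adj_sym)

lemma not_adj_W_perp: "x \<in> W \<Longrightarrow> y \<in> W_perp \<Longrightarrow> \<not> adj x y"
  by (rule not_adj_span) (auto simp: sols_def)

lemma not_adj_W: "x \<in> W \<Longrightarrow> y \<in> W \<Longrightarrow> \<not> adj x y"
  using not_adj_W_perp W_subset_perp by blast

lemma sols_shift: "w \<in> sols U d \<Longrightarrow> v \<in> W_perp \<Longrightarrow> w + v \<in> sols U d"
  by (simp add: sols_def)

lemma W_perp_add: "v \<in> W_perp \<Longrightarrow> w \<in> W_perp \<Longrightarrow> w + v \<in> W_perp"
  by (rule sols_shift)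

lemma card_sols_one:
  assumes "x \<notin> W"
  shows "card {w \<in> sols U d. adj x w = a} = 2 ^ (2 * CARD('n) - card U - 1)"
    and "card U + 1 \<le> 2 * CARD('n)"
proof -
  let ?n = "card {w \<in> sols U d. adj x w = a}"
  have *: "2 ^ (card U + 1) * ?n = 2 ^ (2 * CARD('n))"
    using card_sols_insert[OF assms, of d a] card_sols[OF independent, of d]
    by (simp only: power_add power_one_right mult.assoc)
  have "(2::nat) ^ (card U + 1) dvd 2 ^ (2 * CARD('n))" by (rule dvdI[OF *[symmetric]])
  then show le: "card U + 1 \<le> 2 * CARD('n)" by (rule power_dvd_imp_le) simp
  have "(2::nat) ^ (2 * CARD('n)) = 2 ^ (card U + 1) * 2 ^ (2 * CARD('n) - card U - 1)"
    unfolding power_add[symmetric] using le by simp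
  with * show "?n = 2 ^ (2 * CARD('n) - card U - 1)" by simp
qed

text \<open>Two vectors that are independent modulo \<open>W\<close> impose two further independent conditions.\<close>

lemma card_sols_two:
  assumes "x \<notin> W" "y \<notin> W" "x + y \<notin> W"
  shows "card {w \<in> sols U d. adj x w = a \<and> adj y w = b} = 2 ^ (2 * CARD('n) - card U - 2)"
    and "card U + 2 \<le> 2 * CARD('n)"
proof -
  let ?n = "card {w \<in> sols U d. adj x w = a \<and> adj y w = b}"
  let ?d = "\<lambda>u. if u = x then a else d u"
  have x: "x \<notin> U" using assms(1) vec.span_base by blast
  then have "sols (insert x U) ?d = {w \<in> sols U d. adj x w = a}"
    by (auto simp: sols_def)
  moreover have "y \<notin> vec.span (insert x U)"
    using assms by (simp add: span_insert_bit add.commute)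
  moreover have "{w \<in> sols U d. adj x w = a \<and> adj y w = b} =
      {w \<in> {w \<in> sols U d. adj x w = a}. adj y w = b}" by blast
  ultimately have "2 * ?n = 2 ^ (2 * CARD('n) - card U - 1)"
    using card_sols_insert[of y "insert x U" ?d b] card_sols_one(1)[OF assms(1), of d a] by simp
  moreover have "2 * CARD('n) - card U - 1 \<noteq> 0"
  proof
    assume "2 * CARD('n) - card U - 1 = 0"
    with \<open>2 * ?n = _\<close> have "2 * ?n = 1" by simp
    then show False by presburger
  qed
  ultimately show "?n = 2 ^ (2 * CARD('n) - card U - 2)"
    and "card U + 2 \<le> 2 * CARD('n)"
    by (cases "2 * CARD('n) - card U - 1"; simp)+
qed

text \<open>Vectors that are independent modulo the orthogonal space of \<open>W\<close> restrict to independent functionals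
  on \<open>W\<close>. Each of \<open>x\<close>, \<open>y\<close>, \<open>x + y\<close> is adjacent to one half of \<open>W\<close>, and any vector adjacent to one
  of them is adjacent to exactly two, which leaves a quarter adjacent to none.\<close>

lemma card_W_two:
  assumes "x \<notin> W_perp" "y \<notin> W_perp" "x + y \<notin> W_perp"
  shows "4 * card {w \<in> W. \<not> adj x w \<and> \<not> adj y w} = card W"
proof -
  have half: "2 * card {w \<in> W. adj t w} = card W" if "t \<notin> W_perp" for t
  proof -
    from that obtain p where "p \<in> U" "adj t p" by (auto simp: sols_def adj_sym)
    then have "2 * card {w \<in> W. adj t w = True} = card W"
      by (intro card_toggling_involution[of _ "\<lambda>w. w + p"])
        (auto simp: add.assoc intro: vec.span_add vec.span_base)
    then show ?thesis by simp
  qed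
  let ?A = "{w \<in> W. adj x w}" and ?B = "{w \<in> W. adj y w}" and ?C = "{w \<in> W. adj (x + y) w}"
  have "card (?A \<inter> ?B) + card ?C = card (?A \<union> ?B)"
    by (subst card_Un_disjoint[symmetric]) (auto intro: arg_cong[of _ _ card])
  moreover have "card ?A + card ?B = card (?A \<union> ?B) + card (?A \<inter> ?B)"
    by (rule card_Un_Int) auto
  moreover have "card {w \<in> W. \<not> adj x w \<and> \<not> adj y w} + card (?A \<union> ?B) = card W"
    by (subst card_Un_disjoint[symmetric]) (auto intro: arg_cong[of _ _ card])
  ultimately show ?thesis
    using half[OF assms(1)] half[OF assms(2)] half[OF assms(3)] by linarith
qed

end

lemma isotropic_empty: "isotropic {}"
  by unfold_locales (simp_all add: vec.independent_empty)

lemma card_adj_two: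
  fixes x y :: "'n::finite symp_vec"
  assumes "x \<noteq> 0" "y \<noteq> 0" "x \<noteq> y"
  shows "card {w. adj x w = a \<and> adj y w = b} = 2 ^ (2 * CARD('n) - 2)"
  using isotropic.card_sols_two(1)[OF isotropic_empty, of x y _ a b] assms by simp

lemma card_adj_three:
  fixes x y z :: "'n::finite symp_vec"
  assumes "x \<noteq> 0" "y \<noteq> 0" "z \<noteq> 0" "x \<noteq> y" "y \<noteq> z" "x \<noteq> z" "z \<noteq> x + y"
  shows "card {w. adj x w = a \<and> adj y w = b \<and> adj z w = c} = 2 ^ (2 * CARD('n) - 3)"
proof -
  let ?c = "\<lambda>t. if t = x then a else if t = y then b else c"
  have "z \<noteq> 0 \<and> z \<noteq> x \<and> z \<noteq> y \<and> z + x \<noteq> y"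
    using assms by (metis vec_add_cancel_right(2) add.commute)
  then have "z \<notin> vec.span {x, y}"
    using assms(5) by (auto simp: span_insert_bit add.commute)
  moreover have "x \<notin> vec.span {y}" "y \<notin> vec.span {}"
    using assms by (simp_all add: span_insert_bit)
  ultimately have "vec.independent {z, x, y}"
    using vec.independent_insertI vec.independent_empty by blast
  then have "vec.independent {x, y, z}" by (simp add: insert_commute)
  moreover have "sols {x, y, z} ?c = {w. adj x w = a \<and> adj y w = b \<and> adj z w = c}"
    using assms by (auto simp: sols_def)
  moreover have "card {x, y, z} = 3" using assms by simp
  ultimately have *: "2 ^ 3 * card {w. adj x w = a \<and> adj y w = b \<and> adj z w = c} = 2 ^ (2 * CARD('n))"
    using card_sols[of "{x, y, z}" ?c] by simp
  have "(2::nat) ^ 3 dvd 2 ^ (2 * CARD('n))" by (rule dvdI[OF *[symmetric]])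
  then have "3 \<le> 2 * CARD('n)" by (rule power_dvd_imp_le) simp
  then have "(2::nat) ^ (2 * CARD('n)) = 2 ^ 3 * 2 ^ (2 * CARD('n) - 3)"
    unfolding power_add[symmetric] by simp
  with * show ?thesis by simp
qed


section \<open>The non-zero minimum number of common neighbors\<close>

lemma nonzero_min_common_neighbors_eqI:
  assumes fin: "finite (pverts G)"
    and wit: "x \<in> pverts G" "y \<in> pverts G" "z \<in> pverts G" "x \<noteq> y" "y \<noteq> z" "x \<noteq> z"
      "card (neighbors G x \<inter> neighbors G y \<inter> neighbors G z) = m" "m \<noteq> 0"
    and min: "\<And>x y z. x \<in> pverts G \<Longrightarrow> y \<in> pverts G \<Longrightarrow> z \<in> pverts G \<Longrightarrow>
      x \<noteq> y \<Longrightarrow> y \<noteq> z \<Longrightarrow> x \<noteq> z \<Longrightarrow> neighbors G x \<inter> neighbors G y \<inter> neighbors G z \<noteq> {} \<Longrightarrow>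
      m \<le> card (neighbors G x \<inter> neighbors G y \<inter> neighbors G z)"
  shows "nonzero_min_common_neighbors G = m"
  unfolding nonzero_min_common_neighbors_def
proof (rule Min_eqI)
  let ?c = "\<lambda>(x, y, z). card (neighbors G x \<inter> neighbors G y \<inter> neighbors G z)"
  show "finite ({card (neighbors G x \<inter> neighbors G y \<inter> neighbors G z) | x y z.
      x \<in> pverts G \<and> y \<in> pverts G \<and> z \<in> pverts G \<and> x \<noteq> y \<and> y \<noteq> z \<and> x \<noteq> z} - {0})"
    by (rule finite_subset[of _ "?c ` (pverts G \<times> pverts G \<times> pverts G)"])
      (use fin in \<open>force+\<close>)
  show "m \<in> {card (neighbors G x \<inter> neighbors G y \<inter> neighbors G z) | x y z.
      x \<in> pverts G \<and> y \<in> pverts G \<and> z \<in> pverts G \<and> x \<noteq> y \<and> y \<noteq> z \<and> x \<noteq> z} - {0}"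
    using wit by blast
qed (use min in force)

lemma nonzero_min_common_neighbors_iso:
  assumes "pair_wf_digraph G" "pair_wf_digraph H" "graph_iso G H"
  shows "nonzero_min_common_neighbors G = nonzero_min_common_neighbors H"
proof -
  obtain f where f: "bij_betw f (pverts G) (pverts H)"
    and arcs: "\<And>x y. x \<in> pverts G \<Longrightarrow> y \<in> pverts G \<Longrightarrow> (x, y) \<in> parcs G \<longleftrightarrow> (f x, f y) \<in> parcs H"
    using assms graph_iso_iff_bij by metis
  have inj: "inj_on f (pverts G)" and V: "pverts H = f ` pverts G"
    using f by (auto simp: bij_betw_def)
  have nb: "neighbors H (f x) = f ` neighbors G x" if "x \<in> pverts G" for x
    using that arcs by (auto simp: neighbors_def V)
  have sub: "neighbors G x \<subseteq> pverts G" for x by (auto simp: neighbors_def)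
  have card: "card (neighbors H (f x) \<inter> neighbors H (f y) \<inter> neighbors H (f z)) =
      card (neighbors G x \<inter> neighbors G y \<inter> neighbors G z)"
    if "x \<in> pverts G" "y \<in> pverts G" "z \<in> pverts G" for x y z
  proof -
    have "neighbors H (f x) \<inter> neighbors H (f y) \<inter> neighbors H (f z) =
        f ` (neighbors G x \<inter> neighbors G y \<inter> neighbors G z)"
      unfolding nb[OF that(1)] nb[OF that(2)] nb[OF that(3)]
      using sub inj_on_image_Int[OF inj, of "neighbors G x" "neighbors G y"]
        inj_on_image_Int[OF inj, of "neighbors G x \<inter> neighbors G y" "neighbors G z"]
      by (simp add: le_infI1)
    moreover have "inj_on f (neighbors G x \<inter> neighbors G y \<inter> neighbors G z)"
      using inj by (rule inj_on_subset) (use sub in blast)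
    ultimately show ?thesis by (simp add: card_image)
  qed
  have "{card (neighbors H x \<inter> neighbors H y \<inter> neighbors H z) | x y z.
      x \<in> pverts H \<and> y \<in> pverts H \<and> z \<in> pverts H \<and> x \<noteq> y \<and> y \<noteq> z \<and> x \<noteq> z} =
    {card (neighbors H (f x) \<inter> neighbors H (f y) \<inter> neighbors H (f z)) | x y z.
      x \<in> pverts G \<and> y \<in> pverts G \<and> z \<in> pverts G \<and> f x \<noteq> f y \<and> f y \<noteq> f z \<and> f x \<noteq> f z}"
    unfolding V by blast
  also have "\<dots> = {card (neighbors G x \<inter> neighbors G y \<inter> neighbors G z) | x y z.
      x \<in> pverts G \<and> y \<in> pverts G \<and> z \<in> pverts G \<and> x \<noteq> y \<and> y \<noteq> z \<and> x \<noteq> z}"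
    (is "?L = ?R")
  proof (intro equalityI subsetI)
    fix n assume "n \<in> ?L"
    then obtain x y z where "x \<in> pverts G" "y \<in> pverts G" "z \<in> pverts G"
      "f x \<noteq> f y" "f y \<noteq> f z" "f x \<noteq> f z"
      "n = card (neighbors H (f x) \<inter> neighbors H (f y) \<inter> neighbors H (f z))" by blast
    then show "n \<in> ?R" using card[of x y z] by blast
  next
    fix n assume "n \<in> ?R"
    then obtain x y z where *: "x \<in> pverts G" "y \<in> pverts G" "z \<in> pverts G"
      "x \<noteq> y" "y \<noteq> z" "x \<noteq> z" "n = card (neighbors G x \<inter> neighbors G y \<inter> neighbors G z)" by blast
    then have "f x \<noteq> f y" "f y \<noteq> f z" "f x \<noteq> f z" using inj by (auto dest: inj_onD)
    then show "n \<in> ?L" using * card[of x y z, symmetric] by blast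
  qed
  finally show ?thesis by (simp only: nonzero_min_common_neighbors_def)
qed

text \<open>Independent triples all have the same number of common neighbors, dependent ones have none.\<close>

lemma nonzero_min_common_neighbors_Sp:
  assumes "CARD('n) \<ge> 2"
  shows "nonzero_min_common_neighbors (Sp :: 'n::finite symp_vec pair_pre_digraph) = 2 ^ (2 * CARD('n) - 3)"
proof -
  let ?X = "Sp :: 'n symp_vec pair_pre_digraph"
  have V: "pverts ?X = UNIV - {0}" by (simp add: Sp_def)
  have C: "neighbors ?X x \<inter> neighbors ?X y \<inter> neighbors ?X z = {w. adj x w = True \<and> adj y w = True \<and> adj z w = True}"
    if "x \<noteq> 0" "y \<noteq> 0" "z \<noteq> 0" for x y z
    using that by (auto simp: neighbors_def Sp_def adj_def) (auto simp flip: adj_def)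
  have indep: "card (neighbors ?X x \<inter> neighbors ?X y \<inter> neighbors ?X z) = 2 ^ (2 * CARD('n) - 3)"
    if "x \<noteq> 0" "y \<noteq> 0" "z \<noteq> 0" "x \<noteq> y" "y \<noteq> z" "x \<noteq> z" "z \<noteq> x + y" for x y z
    unfolding C[OF that(1-3)] by (rule card_adj_three[OF that])
  obtain x y z :: "'n symp_vec" where xyz: "x \<noteq> 0" "y \<noteq> 0" "z \<noteq> 0" "x \<noteq> y" "y \<noteq> z" "x \<noteq> z" "z \<noteq> x + y"
  proof -
    obtain l m :: 'n where "l \<noteq> m" using assms
      by (metis (full_types) card_2_iff' ex_card)
    then show ?thesis
      by (intro that[of "axis (l, 1) 1" "axis (l, 2) 1" "axis (m, 1) 1"])
        (auto simp: vec_eq_iff axis_def)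
  qed
  show ?thesis
  proof (rule nonzero_min_common_neighbors_eqI[of _ x y z])
    fix x y z
    assume *: "x \<in> pverts ?X" "y \<in> pverts ?X" "z \<in> pverts ?X" "x \<noteq> y" "y \<noteq> z" "x \<noteq> z"
      and ne: "neighbors ?X x \<inter> neighbors ?X y \<inter> neighbors ?X z \<noteq> {}"
    have "z \<noteq> x + y" using ne * by (auto simp: C V)
    then show "2 ^ (2 * CARD('n) - 3) \<le> card (neighbors ?X x \<inter> neighbors ?X y \<inter> neighbors ?X z)"
      using indep[of x y z] * by (simp add: V)
  qed (use xyz indep[OF xyz] in \<open>simp_all add: V\<close>)
qed

section \<open>Switching with respect to a union of cosets of an isotropic subspace\<close>

text \<open>The common shape of three of the switched graphs: \<open>D\<close> is a union of cosets of \<open>W = span U\<close>, and adjacency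
  is changed precisely between \<open>D\<close> and the vectors outside \<open>W \<union> D\<close>.\<close>

locale coset_switch = isotropic U for U :: "'n::finite symp_vec set" +
  fixes D :: "'n symp_vec set" and G :: "'n symp_vec pair_pre_digraph"
  assumes D_W: "D \<inter> vec.span U = {}"
    and D_shift: "\<And>x v. x \<in> D \<Longrightarrow> v \<in> vec.span U \<Longrightarrow> x + v \<in> D"
    and pverts: "pverts G = UNIV - {0}"
    and parcs: "\<And>x y. (x, y) \<in> parcs G \<longleftrightarrow> x \<noteq> 0 \<and> y \<noteq> 0 \<and>
      adj x y \<noteq> (x \<in> D \<and> y \<notin> vec.span U \<and> y \<notin> D \<or> y \<in> D \<and> x \<notin> vec.span U \<and> x \<notin> D)"
begin

abbreviation R where "R \<equiv> - (W \<union> D)"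

lemma neighbors_W: "x \<noteq> 0 \<Longrightarrow> w \<in> W \<Longrightarrow> w \<in> neighbors G x \<longleftrightarrow> adj x w"
  using D_W by (auto simp: neighbors_def parcs pverts)

lemma neighbors_D: "x \<noteq> 0 \<Longrightarrow> w \<in> D \<Longrightarrow> w \<in> neighbors G x \<longleftrightarrow> adj x w = (x \<notin> R)"
  using D_W vec.span_zero by (auto simp: neighbors_def parcs pverts)

lemma neighbors_R: "x \<noteq> 0 \<Longrightarrow> w \<in> R \<Longrightarrow> w \<in> neighbors G x \<longleftrightarrow> adj x w = (x \<notin> D)"
  using D_W vec.span_zero by (auto simp: neighbors_def parcs pverts)

text \<open>The cells are unions of cosets of \<open>W\<close>, so congruent vectors lie in the same cell.\<close>

lemma mod_W:
  assumes "s + t \<in> W"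
  shows "s \<in> W \<longleftrightarrow> t \<in> W" and "s \<in> D \<longleftrightarrow> t \<in> D"
proof -
  have t: "s + (s + t) = t" "t + (s + t) = s" by simp_all
  show "s \<in> W \<longleftrightarrow> t \<in> W"
    using vec.span_add[OF _ assms, of s] vec.span_add[OF _ assms, of t] unfolding t by blast
  show "s \<in> D \<longleftrightarrow> t \<in> D"
    using D_shift[OF _ assms, of s] D_shift[OF _ assms, of t] unfolding t by blast
qed

text \<open>For a common neighbor \<open>w \<in> D\<close> the values \<open>\<langle>x, w\<rangle>\<close>, \<open>\<langle>y, w\<rangle>\<close>, \<open>\<langle>x + y, w\<rangle>\<close> are prescribed by membership
  in \<open>R\<close>, so the prescribed values must add up correctly. This parity condition excludes vectors of
  \<open>W\<close> from the triple: if \<open>x \<in> W\<close>, say, then \<open>y\<close> and \<open>x + y\<close> are congruent modulo \<open>W\<close> and have equal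
  prescribed values, whereas the value for \<open>x\<close> is one. It also makes the condition for \<open>x + y\<close> follow
  from the other two.\<close>

lemma common_D_dependent:
  assumes "x \<noteq> 0" "y \<noteq> 0" "x \<noteq> y"
    and w: "w \<in> D" "w \<in> neighbors G x \<inter> neighbors G y \<inter> neighbors G (x + y)"
  shows "x \<notin> W" "y \<notin> W" "x + y \<notin> W"
    and "(x + y \<notin> R) = ((x \<notin> R) \<noteq> (y \<notin> R))"
    and "neighbors G x \<inter> neighbors G y \<inter> neighbors G (x + y) \<inter> D =
      {w \<in> D. adj x w = (x \<notin> R) \<and> adj y w = (y \<notin> R)}"
proof -
  have xy: "x + y \<noteq> 0" using assms(3) by simp
  show par: "(x + y \<notin> R) = ((x \<notin> R) \<noteq> (y \<notin> R))"
    using w neighbors_D[OF assms(1) w(1)] neighbors_D[OF assms(2) w(1)] neighbors_D[OF xy w(1)]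
    by auto
  show "x \<notin> W" using par mod_W[of y "x + y"] by auto
  show "y \<notin> W" using par mod_W[of x "x + y"] by auto
  show "x + y \<notin> W" using par mod_W[of x y] by auto
  show "neighbors G x \<inter> neighbors G y \<inter> neighbors G (x + y) \<inter> D =
      {w \<in> D. adj x w = (x \<notin> R) \<and> adj y w = (y \<notin> R)}"
  proof (rule set_eqI)
    fix w
    show "w \<in> neighbors G x \<inter> neighbors G y \<inter> neighbors G (x + y) \<inter> D \<longleftrightarrow>
        w \<in> {w \<in> D. adj x w = (x \<notin> R) \<and> adj y w = (y \<notin> R)}"
    proof (cases "w \<in> D")
      case True
      show ?thesis
        unfolding Int_iff mem_Collect_eq neighbors_D[OF assms(1) True] neighbors_D[OF assms(2) True]
          neighbors_D[OF xy True] par adj_add_left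
        using True by argo
    qed blast
  qed
qed

text \<open>The same parity argument, with \<open>D\<close> and \<open>R\<close> interchanged.\<close>

lemma common_R_dependent:
  assumes "x \<noteq> 0" "y \<noteq> 0" "x \<noteq> y"
    and w: "w \<in> R" "w \<in> neighbors G x \<inter> neighbors G y \<inter> neighbors G (x + y)"
  shows "x \<notin> W" "y \<notin> W" "x + y \<notin> W"
    and "neighbors G x \<inter> neighbors G y \<inter> neighbors G (x + y) \<inter> R =
      {w \<in> R. adj x w = (x \<notin> D) \<and> adj y w = (y \<notin> D)}"
proof -
  have xy: "x + y \<noteq> 0" using assms(3) by simp
  have par: "(x + y \<notin> D) = ((x \<notin> D) \<noteq> (y \<notin> D))"
    using w neighbors_R[OF assms(1) w(1)] neighbors_R[OF assms(2) w(1)] neighbors_R[OF xy w(1)]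
    by auto
  show "x \<notin> W" using par mod_W[of y "x + y"] D_W by auto
  show "y \<notin> W" using par mod_W[of x "x + y"] D_W by auto
  show "x + y \<notin> W" using par mod_W[of x y] D_W by auto
  show "neighbors G x \<inter> neighbors G y \<inter> neighbors G (x + y) \<inter> R =
      {w \<in> R. adj x w = (x \<notin> D) \<and> adj y w = (y \<notin> D)}"
  proof (rule set_eqI)
    fix w
    show "w \<in> neighbors G x \<inter> neighbors G y \<inter> neighbors G (x + y) \<inter> R \<longleftrightarrow>
        w \<in> {w \<in> R. adj x w = (x \<notin> D) \<and> adj y w = (y \<notin> D)}"
    proof (cases "w \<in> R")
      case True
      show ?thesis
        unfolding Int_iff mem_Collect_eq neighbors_R[OF assms(1) True] neighbors_R[OF assms(2) True]
          neighbors_R[OF xy True] par adj_add_left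
        using True by argo
    qed blast
  qed
qed

lemma common_W_dependent:
  assumes "x \<noteq> 0" "y \<noteq> 0" "x \<noteq> y"
  shows "neighbors G x \<inter> neighbors G y \<inter> neighbors G (x + y) \<inter> W = {}"
proof -
  have "x + y \<noteq> 0" using assms(3) by simp
  then show ?thesis using assms neighbors_W by fastforce
qed

text \<open>Triples of this kind attain the minimum in the applications below.\<close>

lemma common_dependent_all_R:
  assumes nz: "x \<noteq> 0" "y \<noteq> 0" "x \<noteq> y" and R: "x \<in> R" "y \<in> R" "x + y \<in> R"
  shows "card (neighbors G x \<inter> neighbors G y \<inter> neighbors G (x + y)) =
    card {w \<in> D. adj x w = False \<and> adj y w = False}"
proof -
  let ?C = "neighbors G x \<inter> neighbors G y \<inter> neighbors G (x + y)"
  have xy: "x + y \<noteq> 0" using nz by simp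
  have "w \<notin> R" if "w \<in> ?C" for w
  proof
    assume w: "w \<in> R"
    have "adj x w" "adj y w" "adj (x + y) w"
      using that R neighbors_R[OF nz(1) w] neighbors_R[OF nz(2) w] neighbors_R[OF xy w] by blast+
    then show False by simp
  qed
  moreover have "?C \<inter> W = {}" by (rule common_W_dependent[OF nz])
  ultimately have "?C \<subseteq> D" by blast
  moreover have "w \<in> ?C \<longleftrightarrow> adj x w = False \<and> adj y w = False" if "w \<in> D" for w
    using R neighbors_D[OF nz(1) that] neighbors_D[OF nz(2) that] neighbors_D[OF xy that] by auto
  ultimately have "?C = {w \<in> D. adj x w = False \<and> adj y w = False}" by blast
  then show ?thesis by simp
qed

lemma card_split: "card A = card (A \<inter> W) + card (A \<inter> D) + card (A \<inter> R)"
proof -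
  have "card A = card (A \<inter> (W \<union> D)) + card (A \<inter> R)"
    by (subst card_Un_disjoint[symmetric]) (auto intro: arg_cong[of _ _ card])
  also have "card (A \<inter> (W \<union> D)) = card (A \<inter> W) + card (A \<inter> D)"
    unfolding Int_Un_distrib using D_W by (intro card_Un_disjoint) auto
  finally show ?thesis .
qed

lemma common_R_eq:
  assumes "x \<noteq> 0" "y \<noteq> 0" "z \<noteq> 0"
  shows "neighbors G x \<inter> neighbors G y \<inter> neighbors G z \<inter> R =
    {w. adj x w = (x \<notin> D) \<and> adj y w = (y \<notin> D) \<and> adj z w = (z \<notin> D)} \<inter> R"
  using neighbors_R[OF assms(1)] neighbors_R[OF assms(2)] neighbors_R[OF assms(3)] by blast

end

text \<open>Members of a dual basis, taken modulo the orthogonal space of \<open>W\<close>; they supply the triples that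
  attain the minimum.\<close>

lemma (in isotropic) dual_vectors:
  assumes "p \<in> U" "q \<in> U" "p \<noteq> q"
  obtains x y where "\<And>u. u \<in> U \<Longrightarrow> adj u x \<longleftrightarrow> u = p" "\<And>u. u \<in> U \<Longrightarrow> adj u y \<longleftrightarrow> u = q"
    and "x \<notin> W_perp" "y \<notin> W_perp" "x + y \<notin> W_perp"
proof -
  obtain x y where x: "x \<in> sols U (\<lambda>u. u = p)" and y: "y \<in> sols U (\<lambda>u. u = q)"
    using sols_nonempty[OF independent] by meson
  show thesis
    by (rule that[of x y]) (use x y assms in \<open>auto simp: sols_def\<close>)
qed

context coset_switch
begin

text \<open>
  Put \<open>q = 2\<^bsup>2\<nu>-k-2\<^esup>\<close>. Two conditions that are independent modulo \<open>W\<close> leave exactly \<open>q\<close> elements of the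
  coset \<open>D\<close> and, because \<open>W\<close> lies in its orthogonal space, at most \<open>q\<close> elements of \<open>W\<close>.

  For a dependent triple the common neighbors in \<open>D\<close> number \<open>q\<close> or zero, and those in \<open>R\<close>, if any,
  at least \<open>8q - q - q\<close>. For an independent triple the equations valid on \<open>R\<close> have at least \<open>4q\<close>
  solutions \<open>E\<close> in the whole space, because \<open>k \<ge> 3\<close>. If the triple lies in \<open>W\<close>, all of \<open>E\<close> consists
  of common neighbors. If two of its members are independent modulo \<open>W\<close>, at most \<open>2q\<close> elements of \<open>E\<close>
  lie in \<open>W \<union> D\<close>. Otherwise up to \<open>2q\<close> solutions may lie in \<open>D\<close>, but the loss
  inside \<open>W\<close> is made up by common neighbors in \<open>W\<close>.
\<close>

lemma nonzero_min_common_neighbors_single_coset: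
  assumes D: "D = sols U d" and m: "m \<in> U" "d m" and k: "3 \<le> card U"
  shows "nonzero_min_common_neighbors G = 2 ^ (2 * CARD('n) - card U - 2)"
proof -
  let ?q = "2 ^ (2 * CARD('n) - card U - 2) :: nat"
  obtain p1 p2 where p: "p1 \<in> U" "p2 \<in> U" "p1 \<noteq> p2" "p1 \<noteq> m" "p2 \<noteq> m"
  proof -
    have "2 \<le> card (U - {m})" using k m by simp
    then obtain T where "T \<subseteq> U - {m}" "card T = 2" using ex_card by metis
    then show thesis using that by (auto simp: card_2_iff)
  qed
  obtain x0 y0 where x0: "\<And>u. u \<in> U \<Longrightarrow> adj u x0 \<longleftrightarrow> u = p1"
    and y0: "\<And>u. u \<in> U \<Longrightarrow> adj u y0 \<longleftrightarrow> u = p2"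
    and perp: "x0 \<notin> W_perp" "y0 \<notin> W_perp" "x0 + y0 \<notin> W_perp"
    using dual_vectors[OF p(1-3)] by metis
  have W0: "x0 \<notin> W" "y0 \<notin> W" "x0 + y0 \<notin> W" using perp W_subset_perp by blast+
  (* all three vectors are orthogonal to m, hence outside D *)
  have R0: "x0 \<in> R" "y0 \<in> R" "x0 + y0 \<in> R"
    using W0 x0[OF m(1)] y0[OF m(1)] m p by (auto simp: D sols_def)
  have le: "card U + 2 \<le> 2 * CARD('n)" by (rule card_sols_two(2)[OF W0])
  have "2 * CARD('n) - card U - 1 = Suc (2 * CARD('n) - card U - 2)" using le by simp
  then have q2: "2 ^ (2 * CARD('n) - card U - 1) = 2 * ?q" by simp
  have q4: "4 * ?q \<le> 2 ^ (2 * CARD('n) - 3)"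
  proof -
    have "2 ^ (2 + (2 * CARD('n) - card U - 2)) \<le> (2::nat) ^ (2 * CARD('n) - 3)"
      by (rule power_increasing) (use le k in simp_all)
    then show ?thesis by (simp add: power_add)
  qed
  have q8: "8 * ?q \<le> 2 ^ (2 * CARD('n) - 2)"
  proof -
    have "2 ^ (3 + (2 * CARD('n) - card U - 2)) \<le> (2::nat) ^ (2 * CARD('n) - 2)"
      by (rule power_increasing) (use le k in simp_all)
    then show ?thesis by (simp add: power_add)
  qed
  have two: "card {w \<in> D. adj s w = a \<and> adj t w = b} = ?q"
    "card {w \<in> W. adj s w = a \<and> adj t w = b} \<le> ?q"
    if "s \<notin> W" "t \<notin> W" "s + t \<notin> W" for s t a b
  proof -
    show "card {w \<in> D. adj s w = a \<and> adj t w = b} = ?q"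
      unfolding D by (rule card_sols_two(1)[OF that])
    have "card {w \<in> W. adj s w = a \<and> adj t w = b} \<le> card {w \<in> W_perp. adj s w = a \<and> adj t w = b}"
      by (rule card_mono) (use W_subset_perp in auto)
    then show "card {w \<in> W. adj s w = a \<and> adj t w = b} \<le> ?q"
      by (simp only: card_sols_two(1)[OF that])
  qed
  show ?thesis
  proof (rule nonzero_min_common_neighbors_eqI[of _ x0 y0 "x0 + y0"])
    have nz: "x0 \<noteq> 0" "y0 \<noteq> 0" "x0 \<noteq> y0" using W0 vec.span_zero by force+
    show "card (neighbors G x0 \<inter> neighbors G y0 \<inter> neighbors G (x0 + y0)) = ?q"
      using common_dependent_all_R[OF nz R0] two(1)[OF W0, of False False] by simp
    show "x0 \<in> pverts G" "y0 \<in> pverts G" "x0 + y0 \<in> pverts G" "x0 \<noteq> y0" "y0 \<noteq> x0 + y0"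
      "x0 \<noteq> x0 + y0"
      using nz by (auto simp: pverts)
  next
    fix x y z
    let ?C = "neighbors G x \<inter> neighbors G y \<inter> neighbors G z"
    assume "x \<in> pverts G" "y \<in> pverts G" "z \<in> pverts G" and xyz: "x \<noteq> y" "y \<noteq> z" "x \<noteq> z"
      and ne: "?C \<noteq> {}"
    then have nz: "x \<noteq> 0" "y \<noteq> 0" "z \<noteq> 0" by (simp_all add: pverts)
    show "?q \<le> card ?C"
    proof (cases "z = x + y")
      case z: True
      consider w where "w \<in> D" "w \<in> ?C" | w where "w \<in> R" "w \<in> ?C"
        using ne common_W_dependent[OF nz(1,2) xyz(1)] z by blast
      then show ?thesis
      proof cases
        case (1 w)
        note * = common_D_dependent[OF nz(1,2) xyz(1) 1[unfolded z]]
        have "?q = card (?C \<inter> D)"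
          unfolding z *(5) by (rule two(1)[OF *(1-3), symmetric])
        also have "\<dots> \<le> card ?C" by (rule card_mono) auto
        finally show ?thesis .
      next
        case (2 w)
        note * = common_R_dependent[OF nz(1,2) xyz(1) 2[unfolded z]]
        let ?E = "{w. adj x w = (x \<notin> D) \<and> adj y w = (y \<notin> D)}"
        have "card ?E = 2 ^ (2 * CARD('n) - 2)" by (rule card_adj_two[OF nz(1,2) xyz(1)])
        moreover have "?E \<inter> R = ?C \<inter> R" unfolding z *(4) by blast
        moreover have "?E \<inter> D = {w \<in> D. adj x w = (x \<notin> D) \<and> adj y w = (y \<notin> D)}"
          "?E \<inter> W = {w \<in> W. adj x w = (x \<notin> D) \<and> adj y w = (y \<notin> D)}" by blast+
        moreover have "card (?C \<inter> R) \<le> card ?C" by (rule card_mono) auto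
        ultimately show ?thesis
          using card_split[of ?E] two[OF *(1-3), of "x \<notin> D" "y \<notin> D"] q8 by simp
      qed
    next
      case False
      let ?E = "{w. adj x w = (x \<notin> D) \<and> adj y w = (y \<notin> D) \<and> adj z w = (z \<notin> D)}"
      have E: "4 * ?q \<le> card ?E"
        using card_adj_three[OF nz xyz False] q4 by simp
      have split: "card ?C + card (?E \<inter> W) + card (?E \<inter> D) = card ?E + card (?C \<inter> W) + card (?C \<inter> D)"
        using card_split[of ?E] card_split[of ?C] common_R_eq[OF nz] by simp
      have inE: "adj t w = (t \<notin> D)" if "t \<in> {x, y, z}" "w \<in> ?E" for t w using that by blast
      consider "x \<in> W" "y \<in> W" "z \<in> W"
        | s t where "s \<in> {x, y, z}" "t \<in> {x, y, z}" "s \<notin> W" "t \<notin> W" "s + t \<notin> W"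
        | s where "s \<in> {x, y, z}" "s \<notin> W"
            "\<And>s t. s \<in> {x, y, z} \<Longrightarrow> t \<in> {x, y, z} \<Longrightarrow> s \<notin> W \<Longrightarrow> t \<notin> W \<Longrightarrow> s + t \<in> W"
        by (cases "\<exists>s\<in>{x, y, z}. \<exists>t\<in>{x, y, z}. s \<notin> W \<and> t \<notin> W \<and> s + t \<notin> W") blast+
      then show ?thesis
      proof cases
        case 1
        then have "x \<notin> D" "y \<notin> D" "z \<notin> D" using D_W by auto
        then have "?C \<inter> W = ?E \<inter> W" "?C \<inter> D = ?E \<inter> D"
          using 1 nz by (auto simp: neighbors_W neighbors_D)
        then show ?thesis using split E by simp
      next
        case (2 s t)
        have "card (?E \<inter> D) \<le> card {w \<in> D. adj s w = (s \<notin> D) \<and> adj t w = (t \<notin> D)}"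
          by (rule card_mono, simp) (use inE[OF 2(1)] inE[OF 2(2)] in blast)
        moreover have "card (?E \<inter> W) \<le> card {w \<in> W. adj s w = (s \<notin> D) \<and> adj t w = (t \<notin> D)}"
          by (rule card_mono, simp) (use inE[OF 2(1)] inE[OF 2(2)] in blast)
        ultimately show ?thesis
          using split E two[OF 2(3-5), of "s \<notin> D" "t \<notin> D"] by linarith
      next
        case (3 s)
        have "card (?E \<inter> D) \<le> card {w \<in> sols U d. adj s w = (s \<notin> D)}"
          by (rule card_mono, simp) (use inE[OF 3(1)] D in blast)
        then have ED: "card (?E \<inter> D) \<le> 2 * ?q"
          by (simp only: card_sols_one(1)[OF 3(2)] q2)
        \<comment> \<open>either a member of the triple lies in \<open>W\<close> and rules out solutions there, or all three are
          congruent modulo \<open>W\<close> and impose the same condition on \<open>W\<close>\<close>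
        have "card (?E \<inter> W) \<le> card (?C \<inter> W)"
        proof (cases "\<exists>t\<in>{x, y, z}. t \<in> W")
          case True
          then obtain t where t: "t \<in> {x, y, z}" "t \<in> W" by blast
          then have "t \<notin> D" using D_W by blast
          then have "?E \<inter> W = {}" using inE[OF t(1)] not_adj_W[OF t(2)] by blast
          then show ?thesis by simp
        next
          case none: False
          have add: "x + t \<in> W" if "t \<in> {x, y, z}" for t
            using 3(3)[of x t] none that by blast
          have same: "t \<in> D \<longleftrightarrow> x \<in> D" if "t \<in> {x, y, z}" for t
            using mod_W(2)[OF add[OF that]] by simp
          have adj_same: "adj t w \<longleftrightarrow> adj x w" if "t \<in> {x, y, z}" "w \<in> W" for t w
            using not_adj_W[OF add[OF that(1)] that(2)] by simp
          have EW: "?E \<inter> W = {w \<in> W. adj x w = (x \<notin> D)}"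
            by (auto simp: same[of y] same[of z] adj_same[of y] adj_same[of z])
          have CW: "?C \<inter> W = {w \<in> W. adj x w}"
            by (auto simp: neighbors_W nz adj_same[of y] adj_same[of z])
          show ?thesis
          proof (cases "x \<in> D")
            case True
            (* translation by m toggles adjacency to x *)
            then have "adj x m" using m by (simp add: D sols_def adj_sym)
            then have "(\<lambda>w. w + m) ` (?E \<inter> W) \<subseteq> ?C \<inter> W"
              using True m(1) unfolding EW CW by (auto intro: vec.span_add vec.span_base)
            then show ?thesis by (intro card_inj_on_le[of "\<lambda>w. w + m"]) simp_all
          qed (use EW CW in simp)
        qed
        then show ?thesis using split E ED by linarith
      qed
    qed
  qed (simp_all add: pverts)
qed

text \<open>
  Now \<open>R\<close> is the complement of the orthogonal space of \<open>W\<close>. By parity, a dependent triple with a common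
  neighbor in \<open>D\<close> has all its members in \<open>R\<close>, as the orthogonal space is closed under addition. Its
  common neighbors are the \<open>q = 2\<^bsup>2\<nu>-5\<^esup>\<close> vectors orthogonal to \<open>W\<close>, \<open>x\<close> and \<open>y\<close>, without the two of
  these that lie in \<open>W\<close>. All other triples with a common neighbor have at least \<open>2q\<close> of them in \<open>R\<close>.
\<close>

lemma nonzero_min_common_neighbors_perp:
  assumes D: "D = W_perp - W" and k: "card U = 3" and nu: "4 \<le> CARD('n)"
  shows "nonzero_min_common_neighbors G = 2 ^ (2 * CARD('n) - 5) - 2"
proof -
  let ?q = "2 ^ (2 * CARD('n) - 5) :: nat"
  obtain p1 p2 where p: "p1 \<in> U" "p2 \<in> U" "p1 \<noteq> p2"
  proof -
    obtain T where "T \<subseteq> U" "card T = 2" using k ex_card[of 2 U] by auto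
    then show thesis using that by (auto simp: card_2_iff)
  qed
  obtain x0 y0 where perp: "x0 \<notin> W_perp" "y0 \<notin> W_perp" "x0 + y0 \<notin> W_perp"
    using dual_vectors[OF p] by metis
  have R: "R = - W_perp" using W_subset_perp D by blast
  have q2: "2 ^ (2 * CARD('n) - 4) = 2 * ?q"
    and q4: "2 ^ (2 * CARD('n) - 3) = 4 * ?q" and q8: "2 ^ (2 * CARD('n) - 2) = 8 * ?q"
  proof -
    have "2 * CARD('n) - 4 = Suc (2 * CARD('n) - 5)" "2 * CARD('n) - 3 = Suc (Suc (2 * CARD('n) - 5))"
      "2 * CARD('n) - 2 = Suc (Suc (Suc (2 * CARD('n) - 5)))" using nu by simp_all
    then show "2 ^ (2 * CARD('n) - 4) = 2 * ?q" "2 ^ (2 * CARD('n) - 3) = 4 * ?q"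
      "2 ^ (2 * CARD('n) - 2) = 8 * ?q" by simp_all
  qed
  have D00: "card {w \<in> D. adj s w = False \<and> adj t w = False} = ?q - 2"
    if "s \<notin> W_perp" "t \<notin> W_perp" "s + t \<notin> W_perp" for s t
  proof -
    have W: "s \<notin> W" "t \<notin> W" "s + t \<notin> W" using that W_subset_perp by blast+
    have "card {w \<in> W. \<not> adj s w \<and> \<not> adj t w} = 2"
      using card_W_two[OF that] card_span_independent[OF independent] k by simp
    moreover have "card {w \<in> W_perp. adj s w = False \<and> adj t w = False} = ?q"
      using card_sols_two(1)[OF W, of "\<lambda>_. False" False False] k by simp
    moreover have "{w \<in> D. adj s w = False \<and> adj t w = False} =
      {w \<in> W_perp. adj s w = False \<and> adj t w = False} - {w \<in> W. \<not> adj s w \<and> \<not> adj t w}"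
      using D by blast
    moreover have "{w \<in> W. \<not> adj s w \<and> \<not> adj t w} \<subseteq> {w \<in> W_perp. adj s w = False \<and> adj t w = False}"
      using W_subset_perp by blast
    ultimately show ?thesis by (simp add: card_Diff_subset)
  qed
  show ?thesis
  proof (rule nonzero_min_common_neighbors_eqI[of _ x0 y0 "x0 + y0"])
    have nz: "x0 \<noteq> 0" "y0 \<noteq> 0" "x0 \<noteq> y0" using perp W_subset_perp vec.span_zero by force+
    have "x0 \<in> R" "y0 \<in> R" "x0 + y0 \<in> R" unfolding R using perp by blast+
    then show "card (neighbors G x0 \<inter> neighbors G y0 \<inter> neighbors G (x0 + y0)) = ?q - 2"
      using common_dependent_all_R[OF nz] D00[OF perp] by simp
    show "x0 \<in> pverts G" "y0 \<in> pverts G" "x0 + y0 \<in> pverts G" "x0 \<noteq> y0" "y0 \<noteq> x0 + y0"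
      "x0 \<noteq> x0 + y0"
      using nz by (auto simp: pverts)
    have "2 ^ 3 \<le> ?q" by (rule power_increasing) (use nu in simp_all)
    then show "?q - 2 \<noteq> 0" by simp
  next
    fix x y z
    let ?C = "neighbors G x \<inter> neighbors G y \<inter> neighbors G z"
    assume "x \<in> pverts G" "y \<in> pverts G" "z \<in> pverts G" and xyz: "x \<noteq> y" "y \<noteq> z" "x \<noteq> z"
      and ne: "?C \<noteq> {}"
    then have nz: "x \<noteq> 0" "y \<noteq> 0" "z \<noteq> 0" by (simp_all add: pverts)
    have CR: "card (?C \<inter> R) \<le> card ?C" by (rule card_mono) auto
    have perp_split: "card A = card (A \<inter> R) + card (A \<inter> W_perp)" for A
      unfolding R by (subst card_Un_disjoint[symmetric]) (auto intro: arg_cong[of _ _ card])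
    show "?q - 2 \<le> card ?C"
    proof (cases "z = x + y")
      case z: True
      consider w where "w \<in> D" "w \<in> ?C" | w where "w \<in> R" "w \<in> ?C"
        using ne common_W_dependent[OF nz(1,2) xyz(1)] z by blast
      then show ?thesis
      proof cases
        case (1 w)
        note * = common_D_dependent[OF nz(1,2) xyz(1) 1[unfolded z]]
        have xyp: "x \<notin> W_perp" "y \<notin> W_perp" "x + y \<notin> W_perp"
        proof -
          have "x \<notin> W_perp \<and> y \<notin> W_perp \<and> x + y \<notin> W_perp"
            using *(4) W_perp_add[of y x] W_perp_add[of "x + y" x, unfolded vec_add_cancel]
              W_perp_add[of "x + y" y, unfolded vec_add_cancel_right]
            unfolding R by blast
          then show "x \<notin> W_perp" "y \<notin> W_perp" "x + y \<notin> W_perp" by blast+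
        qed
        then have "?C \<inter> D = {w \<in> D. adj x w = False \<and> adj y w = False}"
          unfolding z *(5) unfolding R by simp
        then have "?q - 2 = card (?C \<inter> D)" using D00[OF xyp] by simp
        also have "\<dots> \<le> card ?C" by (rule card_mono) auto
        finally show ?thesis .
      next
        case (2 w)
        note * = common_R_dependent[OF nz(1,2) xyz(1) 2[unfolded z]]
        let ?E = "{w. adj x w = (x \<notin> D) \<and> adj y w = (y \<notin> D)}"
        have "card ?E = 2 ^ (2 * CARD('n) - 2)" by (rule card_adj_two[OF nz(1,2) xyz(1)])
        moreover have "?E \<inter> R = ?C \<inter> R" unfolding z *(4) by blast
        moreover have "?E \<inter> W_perp = {w \<in> W_perp. adj x w = (x \<notin> D) \<and> adj y w = (y \<notin> D)}" by blast
        ultimately show ?thesis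
          using perp_split[of ?E] CR q8 card_sols_two(1)[OF *(1-3), of "\<lambda>_. False" "x \<notin> D" "y \<notin> D"] k
          by simp
      qed
    next
      case False
      let ?E = "{w. adj x w = (x \<notin> D) \<and> adj y w = (y \<notin> D) \<and> adj z w = (z \<notin> D)}"
      have E: "card ?E = 4 * ?q"
        using card_adj_three[OF nz xyz False] q4 by simp
      have split: "card ?E = card (?C \<inter> R) + card (?E \<inter> W_perp)"
        using perp_split[of ?E] common_R_eq[OF nz] by simp
      have "card (?E \<inter> W_perp) \<le> 2 * ?q"
      proof (cases "x \<in> W \<and> y \<in> W \<and> z \<in> W")
        case True
        then have "x \<notin> D" using D_W by blast
        then have "?E \<inter> W_perp = {}" using True not_adj_W_perp by blast
        then show ?thesis by simp
      next
        case False
        then obtain s where s: "s \<in> {x, y, z}" "s \<notin> W" by blast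
        have "card (?E \<inter> W_perp) \<le> card {w \<in> W_perp. adj s w = (s \<notin> D)}"
          by (rule card_mono) (use s(1) in auto)
        then show ?thesis
          using card_sols_one(1)[OF s(2), of "\<lambda>_. False" "s \<notin> D"] k q2 by simp
      qed
      then show ?thesis using split E CR by linarith
    qed
  qed (simp_all add: pverts)
qed

end

section \<open>Switching the symplectic graph\<close>

lemma neighbors_Sp: "neighbors Sp x = {w. adj x w}"
  by (auto simp: neighbors_def Sp_def adj_def) (auto simp flip: adj_def)

lemma parcs_gm_switch_Sp:
  "(x, y) \<in> parcs (gm_switch Sp P D) \<longleftrightarrow>
    x \<noteq> 0 \<and> y \<noteq> 0 \<and> adj x y \<noteq> (gm_flip Sp P D x y \<or> gm_flip Sp P D y x)"
  by (auto simp: gm_switch_def Sp_def adj_def)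

lemma pverts_gm_switch_Sp: "pverts (gm_switch Sp P D) = UNIV - {0}"
  by (simp add: gm_switch_def Sp_def)

lemma gm_flip_Sp_iff:
  "gm_flip Sp P D x y \<longleftrightarrow>
    x \<in> D \<and> (\<exists>C\<in>P - {D}. y \<in> C \<and> 2 * card {w \<in> C. adj x w} = card C)"
proof -
  have "neighbors Sp x \<inter> C = {w \<in> C. adj x w}" for C
    by (auto simp: neighbors_Sp)
  moreover have "real m = 1 / 2 * real n \<longleftrightarrow> 2 * m = n" for m n by linarith
  ultimately show ?thesis by (simp only: gm_flip_def)
qed

text \<open>Presence of \<open>y\<close> keeps the cell from being empty; an empty cell would count as half full.\<close>

lemma constant_not_half:
  fixes C :: "'n::finite symp_vec set"
  assumes "y \<in> C" "\<And>w. w \<in> C \<Longrightarrow> adj x w = a"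
  shows "2 * card {w \<in> C. adj x w} \<noteq> card C"
proof -
  have "{w \<in> C. adj x w} = (if a then C else {})" using assms(2) by auto
  moreover have "card C \<noteq> 0" using assms(1) by auto
  ultimately show ?thesis by simp
qed

lemma translation_half:
  assumes "\<And>w. w \<in> C \<Longrightarrow> w + p \<in> C" "adj x p"
  shows "2 * card {w \<in> C. adj x w} = card C"
  using card_toggling_involution[of C "\<lambda>w. w + p" "adj x" True] assms by simp

text \<open>To describe the switching at \<open>x\<close> it suffices to name the cells \<open>H\<close> of which \<open>x\<close> sees one half.\<close>

lemma gm_flip_Sp_halves:
  assumes "x \<in> D" "H \<subseteq> P - {D}"
    and "\<And>C. C \<in> H \<Longrightarrow> 2 * card {w \<in> C. adj x w} = card C"
    and "\<And>C. C \<in> P - H \<Longrightarrow> C \<noteq> D \<Longrightarrow> y \<in> C \<Longrightarrow> 2 * card {w \<in> C. adj x w} \<noteq> card C"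
  shows "gm_flip Sp P D x y \<longleftrightarrow> y \<in> \<Union>H"
  unfolding gm_flip_Sp_iff using assms by blast

lemma pair_wf_digraph_gm_switch: "pair_wf_digraph (gm_switch G P D)"
  by unfold_locales (auto simp: gm_switch_def)

section \<open>The cells defined by four vertices\<close>

text \<open>In terms of \<open>W = span {v1, v2, v3}\<close>, the sets \<open>S\<close> and \<open>T\<close> make up the non-zero vectors of \<open>W\<close>, \<open>S\<^sub>0\<close> is the
  orthogonal space of \<open>W\<close> without zero, and \<open>S\<^sub>4\<close> is a coset of that space. The number of \<open>v \<in> S\<close>
  adjacent to \<open>x\<close> is even because the vectors of \<open>S\<close> add up to zero.\<close>

locale isotropic_quadruple =
  fixes v1 v2 v3 :: "'n::finite symp_vec"
  assumes indep: "vec.independent {v1, v2, v3}"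
    and card_quadruple: "card {v1, v2, v3, v1 + v2 + v3} = 4"
    and orth: "\<And>x y. x \<in> {v1, v2, v3} \<Longrightarrow> y \<in> {v1, v2, v3} \<Longrightarrow> \<not> adj x y"
begin

sublocale isotropic "{v1, v2, v3}"
  by unfold_locales (use indep orth in auto)

abbreviation S where "S \<equiv> {v1, v2, v3, v1 + v2 + v3}"
abbreviation T where "T \<equiv> {v1 + v2, v2 + v3, v3 + v1}"
abbreviation S4 where "S4 \<equiv> sols {v1, v2, v3} (\<lambda>_. True)"

lemma distinct: "v1 \<noteq> v2" "v1 \<noteq> v3" "v2 \<noteq> v3"
  "v1 + v2 + v3 \<noteq> v1" "v1 + v2 + v3 \<noteq> v2" "v1 + v2 + v3 \<noteq> v3"
  using card_quadruple by (auto simp: card_insert_if split: if_splits)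

lemma span_eq: "W = insert 0 (S \<union> T)"
proof -
  have eq: "x + a = b \<longleftrightarrow> x = a + b" for x a b :: "'n symp_vec"
    using vec_add_cancel_right[of x a] vec_add_cancel_right[of b a] by (auto simp: add.commute)
  have "x \<in> W \<longleftrightarrow> x \<in> insert 0 (S \<union> T)" for x
    by (simp add: span_insert_bit eq add.assoc) (auto simp: add.commute[of v3 v1])
  then show ?thesis by blast
qed

lemma card_level:
  "card {v \<in> S. symp_form x v = 1} =
    of_bool (adj x v1) + of_bool (adj x v2) + of_bool (adj x v3) + of_bool (adj x (v1 + v2 + v3))"
proof -
  have "card {v \<in> S. symp_form x v = 1} = (\<Sum>v\<in>S. of_bool (adj x v))"
    by (simp only: adj_def of_bool_def card_eq_sum sum.inter_filter finite.intros)
  also have "\<dots> = of_bool (adj x v1) + (of_bool (adj x v2) + (of_bool (adj x v3) + of_bool (adj x (v1 + v2 + v3))))"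
    using distinct distinct[symmetric] by (simp only: sum.insert finite.intros insert_iff empty_iff simp_thms sum.empty add_0_right)
  finally show ?thesis by (simp only: add.assoc)
qed

lemma mem_sols: "x \<in> sols {v1, v2, v3} c \<longleftrightarrow> adj x v1 = c v1 \<and> adj x v2 = c v2 \<and> adj x v3 = c v3"
  by (simp add: sols_def adj_sym[of x])

lemma S_level_0: "S_level S 0 = W_perp - {0}"
proof (rule set_eqI)
  fix x
  show "x \<in> S_level S 0 \<longleftrightarrow> x \<in> W_perp - {0}"
    unfolding S_level_def mem_Collect_eq card_level Diff_iff mem_sols
    by (cases "adj x v1"; cases "adj x v2"; cases "adj x v3") (simp_all add: Sp_def)
qed

lemma S_level_4: "S_level S 4 = S4"
proof (rule set_eqI)
  fix x
  show "x \<in> S_level S 4 \<longleftrightarrow> x \<in> S4"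
    unfolding S_level_def mem_Collect_eq card_level mem_sols
    by (cases "adj x v1"; cases "adj x v2"; cases "adj x v3"; cases "x = 0") (simp_all add: Sp_def)
qed

lemma S_level_2: "S_level S 2 = - (W_perp \<union> S4)"
proof (rule set_eqI)
  fix x
  show "x \<in> S_level S 2 \<longleftrightarrow> x \<in> - (W_perp \<union> S4)"
    unfolding S_level_def mem_Collect_eq card_level Compl_iff Un_iff mem_sols
    by (cases "adj x v1"; cases "adj x v2"; cases "adj x v3"; cases "x = 0") (simp_all add: Sp_def)
qed

lemma S_partition_eq: "S_partition S T = {S, T, W_perp - W, - (W_perp \<union> S4), S4}"
proof -
  have "S_level S 0 - (S \<union> T) = W_perp - W" unfolding S_level_0 span_eq by blast
  then show ?thesis by (simp only: S_partition_def S_level_2 S_level_4)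
qed

lemma S4_notin: "x \<in> S4 \<Longrightarrow> x \<notin> W_perp"
  by (simp add: mem_sols)

lemma S4_shift: "x \<in> S4 \<Longrightarrow> y \<in> W_perp \<Longrightarrow> x + y \<in> S4"
  by (rule sols_shift)

lemma S_subset: "S \<subseteq> W" and T_subset: "T \<subseteq> W"
  unfolding span_eq by blast+

abbreviation S2 where "S2 \<equiv> - (W_perp \<union> S4)"

lemma S2_shift: "w \<in> S2 \<Longrightarrow> v \<in> W_perp \<Longrightarrow> w + v \<in> S2"
  using W_perp_add[of "w + v" v] sols_shift[of "w + v" "\<lambda>_. True" v] W_perp_add[of v "w + v"] by auto

text \<open>Translation by an element of \<open>S\<^sub>4\<close> replaces the set of \<open>v \<in> S\<close> adjacent to a vector by its complement.
  It therefore preserves \<open>S\<^sub>2\<close> and toggles adjacency to every element of \<open>S\<close>.\<close>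

lemma gm_flip_S: "gm_flip Sp (S_partition S T) S x y \<longleftrightarrow> x \<in> S \<and> y \<in> S2"
proof (cases "x \<in> S")
  case True
  then have xW: "x \<in> W" by (simp add: span_eq)
  have x: "adj x w = a" if "adj w v1 = a" "adj w v2 = a" "adj w v3 = a" for w a
    using True that by (auto simp: adj_sym[of _ w])
  have "gm_flip Sp (S_partition S T) S x y \<longleftrightarrow> y \<in> \<Union>{S2}"
    unfolding S_partition_eq
  proof (rule gm_flip_Sp_halves[OF True])
    have "S2 \<noteq> S" using True xW W_subset_perp by blast
    then show "{S2} \<subseteq> {S, T, W_perp - W, S2, S4} - {S}" by blast
  next
    fix C assume "C \<in> {S2}"
    obtain p where p: "p \<in> S4" using sols_nonempty[OF indep] by blast
    have "adj x p" using x[of p True] p by (simp add: mem_sols)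
    moreover have "w + p \<in> S2" if "w \<in> S2" for w
      using that p by (auto simp: mem_sols)
    ultimately have "2 * card {w \<in> S2. adj x w} = card S2" by (intro translation_half)
    with \<open>C \<in> {S2}\<close> show "2 * card {w \<in> C. adj x w} = card C" by simp
  next
    fix C assume "C \<in> {S, T, W_perp - W, S2, S4} - {S2}" "C \<noteq> S" "y \<in> C"
    then have "C = T \<or> C = W_perp - W \<or> C = S4"
      unfolding Diff_iff insert_iff empty_iff by argo
    then consider "C \<subseteq> W_perp" | "C = S4"
      using subset_trans[OF T_subset W_subset_perp] Diff_subset by metis
    then show "2 * card {w \<in> C. adj x w} \<noteq> card C"
    proof cases
      case 1
      then have "adj x w = False" if "w \<in> C" for w using that not_adj_W_perp[OF xW] by blast
      then show ?thesis by (rule constant_not_half[OF \<open>y \<in> C\<close>])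
    next
      case 2
      then have "adj x w = True" if "w \<in> C" for w using that x by (simp add: mem_sols)
      then show ?thesis by (rule constant_not_half[OF \<open>y \<in> C\<close>])
    qed
  qed
  with True show ?thesis by simp
qed (simp add: gm_flip_Sp_iff)

text \<open>The vector \<open>v1\<close> is adjacent to all of \<open>S\<^sub>4\<close>, and translation by it preserves every coset of \<open>W\<close>.
  On \<open>S\<close> and \<open>T\<close> adjacency to an element of \<open>S\<^sub>4\<close> is constant.\<close>

lemma gm_flip_S4: "gm_flip Sp (S_partition S T) S4 x y \<longleftrightarrow> x \<in> S4 \<and> y \<notin> W \<and> y \<notin> S4"
proof (cases "x \<in> S4")
  case True
  then have xW: "x \<notin> W" using S4_notin W_subset_perp by blast
  have "gm_flip Sp (S_partition S T) S4 x y \<longleftrightarrow> y \<in> \<Union>{W_perp - W, S2}"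
    unfolding S_partition_eq
  proof (rule gm_flip_Sp_halves[OF True])
    have "W_perp - W \<noteq> S4" "S2 \<noteq> S4" using True S4_notin by blast+
    then show "{W_perp - W, S2} \<subseteq> {S, T, W_perp - W, S2, S4} - {S4}" by blast
  next
    fix C assume C: "C \<in> {W_perp - W, S2}"
    have v1: "v1 \<in> W" by (simp add: vec.span_base)
    have "w + v1 \<in> C" if "w \<in> C" for w
      using C
    proof (elim insertE emptyE)
      assume "C = W_perp - W"
      then show ?thesis
        using that v1 W_perp_add[of w v1] W_subset_perp span_add_left_iff[OF v1, of w]
        by (auto simp: add.commute)
    next
      assume "C = S2"
      then show ?thesis using that v1 S2_shift W_subset_perp by blast
    qed
    moreover have "adj x v1" using True by (simp add: mem_sols)
    ultimately show "2 * card {w \<in> C. adj x w} = card C" by (rule translation_half)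
  next
    fix C assume "C \<in> {S, T, W_perp - W, S2, S4} - {W_perp - W, S2}" "C \<noteq> S4" "y \<in> C"
    then consider "C = S" | "C = T"
      unfolding Diff_iff insert_iff empty_iff by argo
    then show "2 * card {w \<in> C. adj x w} \<noteq> card C"
    proof cases
      case 1
      then have "adj x w = True" if "w \<in> C" for w using that True by (auto simp: mem_sols)
      then show ?thesis by (rule constant_not_half[OF \<open>y \<in> C\<close>])
    next
      case 2
      then have "adj x w = False" if "w \<in> C" for w using that True by (auto simp: mem_sols)
      then show ?thesis by (rule constant_not_half[OF \<open>y \<in> C\<close>])
    qed
  qed
  also have "\<dots> \<longleftrightarrow> y \<notin> W \<and> y \<notin> S4" using W_subset_perp S4_notin by blast
  finally show ?thesis using True by simp
qed (simp add: gm_flip_Sp_iff)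

text \<open>Here \<open>x\<close> lies outside \<open>W\<close>, so some vector orthogonal to \<open>W\<close> is adjacent to it; translation by that
  vector preserves \<open>S\<^sub>2\<close> and \<open>S\<^sub>4\<close>.\<close>

lemma gm_flip_S0:
  "gm_flip Sp (S_partition S T) (W_perp - W) x y \<longleftrightarrow> x \<in> W_perp - W \<and> y \<notin> W_perp"
proof (cases "x \<in> W_perp - W")
  case True
  then have xW: "x \<notin> W" by blast
  have "gm_flip Sp (S_partition S T) (W_perp - W) x y \<longleftrightarrow> y \<in> \<Union>{S2, S4}"
    unfolding S_partition_eq
  proof (rule gm_flip_Sp_halves[OF True])
    have "S2 \<noteq> W_perp - W" "S4 \<noteq> W_perp - W" using True S4_notin by blast+
    then show "{S2, S4} \<subseteq> {S, T, W_perp - W, S2, S4} - {W_perp - W}" by blast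
  next
    fix C assume C: "C \<in> {S2, S4}"
    obtain p where p: "p \<in> W_perp" "adj x p"
      using separating_vector[OF xW] by (auto simp: sols_def)
    have "w + p \<in> C" if "w \<in> C" for w
      using C that S2_shift[OF _ p(1)] S4_shift[OF _ p(1)] by blast
    then show "2 * card {w \<in> C. adj x w} = card C" using p(2) by (rule translation_half)
  next
    fix C assume "C \<in> {S, T, W_perp - W, S2, S4} - {S2, S4}" "C \<noteq> W_perp - W" "y \<in> C"
    then have "C = S \<or> C = T" unfolding Diff_iff insert_iff empty_iff by argo
    then have "C \<subseteq> W" using S_subset T_subset by metis
    then have "adj x w = False" if "w \<in> C" for w
      using that True not_adj_W_perp[of w x] by (auto simp: adj_sym[of x])
    then show "2 * card {w \<in> C. adj x w} \<noteq> card C" by (rule constant_not_half[OF \<open>y \<in> C\<close>])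
  qed
  also have "\<dots> \<longleftrightarrow> y \<notin> W_perp" using S4_notin by blast
  finally show ?thesis using True by simp
qed (simp only: gm_flip_Sp_iff, blast)

lemma card_basis: "card {v1, v2, v3} = 3"
  using distinct by simp

lemma nonzero_min_S4:
  "nonzero_min_common_neighbors (gm_switch Sp (S_partition S T) S4) = 2 ^ (2 * CARD('n) - 5)"
proof -
  interpret coset_switch "{v1, v2, v3}" S4 "gm_switch Sp (S_partition S T) S4"
  proof
    show "S4 \<inter> W = {}" using S4_notin W_subset_perp by blast
    show "x + v \<in> S4" if "x \<in> S4" "v \<in> W" for x v
      using that S4_shift W_subset_perp by blast
  qed (auto simp: pverts_gm_switch_Sp parcs_gm_switch_Sp gm_flip_S4)
  show ?thesis
    using nonzero_min_common_neighbors_single_coset[OF refl, of v1] card_basis by simp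
qed

lemma nonzero_min_S0:
  assumes "4 \<le> CARD('n)"
  shows "nonzero_min_common_neighbors (gm_switch Sp (S_partition S T) (W_perp - W)) =
    2 ^ (2 * CARD('n) - 5) - 2"
proof -
  interpret coset_switch "{v1, v2, v3}" "W_perp - W" "gm_switch Sp (S_partition S T) (W_perp - W)"
  proof
    show "x + v \<in> W_perp - W" if "x \<in> W_perp - W" "v \<in> W" for x v
      using that W_perp_add[of x v] W_subset_perp span_add_left_iff[OF that(2), of x]
      by (auto simp: add.commute)
  qed (use W_subset_perp in \<open>auto simp: pverts_gm_switch_Sp parcs_gm_switch_Sp gm_flip_S0\<close>)
  show ?thesis
    by (rule nonzero_min_common_neighbors_perp[OF refl card_basis assms])
qed

text \<open>
  Choose \<open>p\<close> adjacent to \<open>v1\<close> and \<open>v2\<close> but not \<open>v3\<close>, and \<open>q\<close> adjacent to \<open>v1\<close> and \<open>v3\<close> but not \<open>v2\<close>. Then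
  \<open>p\<close>, \<open>q\<close>, \<open>p + q\<close> lie in \<open>S\<^sub>2\<close>, and as they add up to zero they have no common neighbor outside \<open>S\<close>.
  After switching, their neighbors in \<open>S\<close> are those \<open>v\<close> to which they were not adjacent; the only
  such \<open>v\<close> common to all three is \<open>v1 + v2 + v3\<close>.
\<close>

lemma nonzero_min_S:
  "nonzero_min_common_neighbors (gm_switch Sp (S_partition S T) S) = 1"
proof -
  let ?G = "gm_switch Sp (S_partition S T) S"
  have v: "v1 \<in> {v1, v2, v3}" "v2 \<in> {v1, v2, v3}" "v3 \<in> {v1, v2, v3}" by simp_all
  obtain p where p: "p \<in> sols {v1, v2, v3} (\<lambda>u. u \<noteq> v3)"
    using sols_nonempty[OF indep] by blast
  obtain q where q: "q \<in> sols {v1, v2, v3} (\<lambda>u. u \<noteq> v2)"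
    using sols_nonempty[OF indep] by blast
  have p': "adj p v1" "adj p v2" "\<not> adj p v3" and q': "adj q v1" "\<not> adj q v2" "adj q v3"
    using p q distinct by (auto simp: mem_sols)
  have S2: "p \<in> S2" "q \<in> S2" "p + q \<in> S2"
    using p' q' by (auto simp: mem_sols)
  have notS: "x \<notin> S" if "x \<in> S2" for x
    using that W_subset_perp span_eq by blast
  have nb: "w \<in> neighbors ?G x \<longleftrightarrow> w \<noteq> 0 \<and> adj x w \<noteq> (w \<in> S)" if "x \<in> S2" for w x
  proof -
    have "x \<noteq> 0" using that vec.span_zero W_subset_perp by blast
    then show ?thesis
      using that notS[OF that]
      by (auto simp: neighbors_def pverts_gm_switch_Sp parcs_gm_switch_Sp gm_flip_S)
  qed
  have "neighbors ?G p \<inter> neighbors ?G q \<inter> neighbors ?G (p + q) = {v1 + v2 + v3}" (is "?C = _")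
  proof (rule equalityI; rule subsetI)
    fix w assume "w \<in> ?C"
    then have w: "adj p w \<noteq> (w \<in> S)" "adj q w \<noteq> (w \<in> S)" "adj (p + q) w \<noteq> (w \<in> S)"
      using nb[OF S2(1)] nb[OF S2(2)] nb[OF S2(3)] by blast+
    then have "w \<in> S" by auto
    with w p' q' show "w \<in> {v1 + v2 + v3}" by auto
  next
    fix w assume w: "w \<in> {v1 + v2 + v3}"
    obtain r where "r \<in> S4" using sols_nonempty[OF indep] by blast
    then have "adj r (v1 + v2 + v3)" by (simp add: mem_sols)
    then have "v1 + v2 + v3 \<noteq> 0" by (metis adj_zero(2))
    with w p' q' show "w \<in> ?C"
      unfolding Int_iff nb[OF S2(1)] nb[OF S2(2)] nb[OF S2(3)] by simp
  qed
  then have one: "card (neighbors ?G p \<inter> neighbors ?G q \<inter> neighbors ?G (p + q)) = 1" by simp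
  have nz: "p \<noteq> 0" "q \<noteq> 0" "p \<noteq> q" using p' q' by auto
  show ?thesis
  proof (rule nonzero_min_common_neighbors_eqI[of _ p q "p + q"])
    fix x y z
    assume "neighbors ?G x \<inter> neighbors ?G y \<inter> neighbors ?G z \<noteq> {}"
    then show "1 \<le> card (neighbors ?G x \<inter> neighbors ?G y \<inter> neighbors ?G z)"
      by (simp add: Suc_le_eq card_gt_0_iff)
  qed (use nz one in \<open>auto simp: pverts_gm_switch_Sp\<close>)
qed

end

section \<open>The cell of vectors all of whose blocks have weight one\<close>

lemma weight_block:
  "weight (block x l) = of_bool (x $ (l, 1) = 1) + of_bool (x $ (l, 2) = 1)"
proof -
  have "{a :: 2. block x l $ a \<noteq> 0} =
      (if x $ (l, 1) = 1 then {1} else {}) \<union> (if x $ (l, 2) = 1 then {2} else {})"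
  proof (rule set_eqI)
    fix a :: 2
    show "a \<in> {a. block x l $ a \<noteq> 0} \<longleftrightarrow> a \<in> (if x $ (l, 1) = 1 then {1} else {}) \<union>
        (if x $ (l, 2) = 1 then {2} else {})"
      using exhaust_2[of a] by (auto simp: block_def)
  qed
  then show ?thesis by (simp add: weight_def)
qed

text \<open>
  The vectors with a single non-zero block, of weight two, span a subspace \<open>W\<close> that is its own
  orthogonal space: \<open>W\<close> consists of the vectors without blocks of weight one, and \<open>O(0,\<nu>,0)\<close> is one of
  its cosets.
\<close>

definition full_block :: "'n::finite \<Rightarrow> 'n symp_vec" where
  "full_block l = axis (l, 1) 1 + axis (l, 2) 1"

lemma full_block_nth: "full_block l $ (m, a) = (if m = l then 1 else 0)"
  using exhaust_2[of a] by (auto simp: full_block_def axis_def)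

lemma adj_full_block: "adj x (full_block l) \<longleftrightarrow> x $ (l, 1) \<noteq> x $ (l, 2)"
  unfolding full_block_def adj_add_right adj_axis
  by (cases "x $ (l, 1)"; cases "x $ (l, 2)") simp_all

lemma weight_block_eq_1: "weight (block x l) = 1 \<longleftrightarrow> adj x (full_block l)"
  unfolding weight_block adj_full_block
  by (cases "x $ (l, 1)"; cases "x $ (l, 2)") simp_all

lemma weight_block_add_full_block:
  assumes "adj x (full_block l)"
  shows "weight (block (x + full_block l) m) = weight (block x m)"
  using assms unfolding weight_block adj_full_block
  by (cases "x $ (l, 1)"; cases "x $ (l, 2)") (auto simp: full_block_nth)

lemma independentI_dual:
  assumes "\<And>u. u \<in> U \<Longrightarrow> \<exists>p. adj u p \<and> (\<forall>v\<in>U - {u}. \<not> adj v p)"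
  shows "vec.independent U"
  unfolding vec.dependent_def
proof
  assume "\<exists>a\<in>U. a \<in> vec.span (U - {a})"
  then obtain a where a: "a \<in> U" "a \<in> vec.span (U - {a})" by blast
  then show False using assms[OF a(1)] not_adj_span[OF a(2)] by blast
qed

interpretation blocks: isotropic "range (full_block :: 'n::finite \<Rightarrow> 'n symp_vec)"
proof
  show "vec.independent (range (full_block :: 'n \<Rightarrow> 'n symp_vec))"
  proof (rule independentI_dual)
    fix u :: "'n symp_vec" assume "u \<in> range full_block"
    then obtain l where "u = full_block l" by blast
    then show "\<exists>p. adj u p \<and> (\<forall>v\<in>range full_block - {u}. \<not> adj v p)"
      by (intro exI[of _ "axis (l, 1) 1"]) (auto simp: adj_axis full_block_nth split: if_splits)
  qed
qed (auto simp: adj_full_block full_block_nth)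

lemma card_range_full_block: "card (range (full_block :: 'n::finite \<Rightarrow> 'n symp_vec)) = CARD('n)"
proof (rule card_image, rule injI)
  fix l m :: 'n assume "full_block l = full_block m"
  then have "full_block l $ (l, 1) = full_block m $ (l, 1)" by simp
  then show "l = m" by (simp add: full_block_nth split: if_splits)
qed

text \<open>The span is contained in its orthogonal space, and both have \<open>2\<^bsup>\<nu>\<^esup>\<close> elements.\<close>

lemma span_full_blocks:
  "x \<in> vec.span (range full_block) \<longleftrightarrow> (\<forall>l. \<not> adj x (full_block l))"
    for x :: "'n::finite symp_vec"
proof -
  let ?P = "sols (range (full_block :: 'n \<Rightarrow> 'n symp_vec)) (\<lambda>_. False)"
  have "2 ^ CARD('n) * card ?P = 2 ^ CARD('n) * 2 ^ CARD('n)"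
    using card_sols[OF blocks.independent, of "\<lambda>_. False"]
    by (simp add: card_range_full_block mult_2 power_add)
  then have "card ?P = card (vec.span (range (full_block :: 'n \<Rightarrow> 'n symp_vec)))"
    by (simp add: card_span_independent[OF blocks.independent] card_range_full_block)
  then have "vec.span (range (full_block :: 'n \<Rightarrow> 'n symp_vec)) = ?P"
    using blocks.W_subset_perp by (intro card_subset_eq) simp_all
  then show ?thesis by (auto simp: sols_def adj_sym)
qed

lemma mem_weight_one_cell:
  "x \<in> O_set 0 CARD('n) 0 \<longleftrightarrow> (\<forall>l. adj x (full_block l))" for x :: "'n::finite symp_vec"
proof
  assume "x \<in> O_set 0 CARD('n) 0"
  then have "{l. weight (block x l) = 1} = UNIV"
    by (intro card_eq_UNIV_imp_eq_UNIV) (simp_all add: O_set_def)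
  then show "\<forall>l. adj x (full_block l)" using weight_block_eq_1 by blast
next
  assume "\<forall>l. adj x (full_block l)"
  then have "weight (block x l) = 1" for l using weight_block_eq_1 by blast
  then show "x \<in> O_set 0 CARD('n) 0" by (simp add: O_set_def)
qed

lemma weight_one_cell_eq: "O_set 0 CARD('n) 0 = sols (range (full_block :: 'n::finite \<Rightarrow> _)) (\<lambda>_. True)"
  by (auto simp: mem_weight_one_cell sols_def adj_sym)

lemma of_nat_bit_eq_1: "(of_nat n :: bit) = 1 \<longleftrightarrow> odd n"
  by (induction n) auto

text \<open>A block of weight two pairs to one with any block of weight one, a zero block pairs to zero. Thus
  adjacency to \<open>x\<close> is constant on each \<open>O(i,0,k)\<close>.\<close>

lemma adj_weight_one_cell:
  fixes x y :: "'n::finite symp_vec"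
  assumes x: "\<forall>l. adj x (full_block l)" and y: "\<forall>l. \<not> adj y (full_block l)"
  shows "adj x y \<longleftrightarrow> odd (card {l. weight (block y l) = 2})"
proof -
  have "x $ (l, 1) * y $ (l, 2) + x $ (l, 2) * y $ (l, 1) = of_bool (weight (block y l) = 2)" for l
    using x[rule_format, of l] y[rule_format, of l] unfolding weight_block adj_full_block
    by (cases "x $ (l, 1)"; cases "x $ (l, 2)"; cases "y $ (l, 1)"; cases "y $ (l, 2)") simp_all
  then have "symp_form x y = (\<Sum>l\<in>UNIV. of_bool (weight (block y l) = 2))"
    unfolding symp_form_eq by (intro sum.cong refl)
  also have "\<dots> = of_nat (card {l. weight (block y l) = 2})"
    by simp
  finally show ?thesis by (simp only: adj_def of_nat_bit_eq_1)
qed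

lemma sum_card_weights:
  "card {l. weight (block x l) = 2} + card {l. weight (block x l) = 1} + card {l. weight (block x l) = 0}
    = CARD('n)" for x :: "'n::finite symp_vec"
proof -
  let ?A = "\<lambda>i. {l. weight (block x l) = i}"
  have "weight (block x l) = 2 \<or> weight (block x l) = 1 \<or> weight (block x l) = 0" for l
    by (simp add: weight_block)
  then have "UNIV = ?A 2 \<union> ?A 1 \<union> ?A 0" by blast
  then have "CARD('n) = card (?A 2 \<union> ?A 1 \<union> ?A 0)" by (rule arg_cong)
  also have "\<dots> = card (?A 2 \<union> ?A 1) + card (?A 0)"
    by (rule card_Un_disjoint) auto
  also have "card (?A 2 \<union> ?A 1) = card (?A 2) + card (?A 1)"
    by (rule card_Un_disjoint) auto
  finally show ?thesis ..
qed

text \<open>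
  On a cell \<open>O(i,j,k)\<close> with \<open>j > 0\<close>, adding the full block at a position where \<open>w\<close> has a block of weight one
  toggles adjacency to \<open>x\<close> and preserves the weights of all blocks. The position depends only on the
  set of blocks of weight one, which is the same before and after, so this is an involution.
\<close>

lemma gm_flip_weight_one_cell:
  fixes x y :: "'n::finite symp_vec"
  shows "gm_flip Sp O_partition (O_set 0 CARD('n) 0) x y \<longleftrightarrow>
    x \<in> O_set 0 CARD('n) 0 \<and> y \<notin> vec.span (range full_block) \<and> y \<notin> O_set 0 CARD('n) 0"
    (is "?flip \<longleftrightarrow> x \<in> ?D \<and> y \<notin> ?W \<and> y \<notin> ?D")
proof
  assume ?flip
  then obtain C where x: "x \<in> ?D" and C: "C \<in> O_partition" "C \<noteq> ?D" "y \<in> C"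
    and half: "2 * card {w \<in> C. adj x w} = card C"
    unfolding gm_flip_Sp_iff by blast
  from C(1) obtain i j k where ijk: "C = O_set i j k" by (auto simp: O_partition_def)
  have "y \<notin> ?D"
  proof
    assume "y \<in> ?D"
    with C(3) have "i = 0 \<and> j = CARD('n) \<and> k = 0" unfolding ijk O_set_def by auto
    with C(2) ijk show False by simp
  qed
  moreover have "y \<notin> ?W"
  proof
    assume "y \<in> ?W"
    then have "j = 0"
      using C(3) unfolding span_full_blocks ijk O_set_def by (simp add: weight_block_eq_1[symmetric])
    then have "adj x w = odd i" if "w \<in> C" for w
      using that x adj_weight_one_cell[of x w] unfolding ijk mem_weight_one_cell
      by (auto simp: O_set_def weight_block_eq_1[symmetric])
    with half show False using constant_not_half[OF C(3)] by blast
  qed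
  ultimately show "x \<in> ?D \<and> y \<notin> ?W \<and> y \<notin> ?D" using x by blast
next
  assume *: "x \<in> ?D \<and> y \<notin> ?W \<and> y \<notin> ?D"
  define i j k where "i = card {l. weight (block y l) = 2}" and "j = card {l. weight (block y l) = 1}"
    and "k = card {l. weight (block y l) = 0}"
  let ?C = "O_set i j k :: 'n symp_vec set"
  have sum: "i + j + k = CARD('n)" unfolding i_def j_def k_def by (rule sum_card_weights)
  have j: "j \<noteq> 0"
    using * unfolding span_full_blocks j_def weight_block_eq_1 by auto
  have y: "y \<in> ?C" by (simp add: O_set_def i_def j_def k_def)
  have C: "?C \<in> O_partition - {?D}"
    using sum j y * by (auto simp: O_partition_def)
  define g where "g w = w + full_block (SOME l. adj w (full_block l))" for w :: "'n symp_vec"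
  have "2 * card {w \<in> ?C. adj x w = True} = card ?C"
  proof (rule card_toggling_involution[of _ g])
    fix w assume w: "w \<in> ?C"
    define l where "l = (SOME l. adj w (full_block l))"
    have "card {l. adj w (full_block l)} = j"
      using w unfolding O_set_def weight_block_eq_1 by simp
    then have "\<exists>l. adj w (full_block l)" using j by (metis Collect_empty_eq card.empty)
    then have l: "adj w (full_block l)" unfolding l_def by (auto intro: someI)
    have g: "g w = w + full_block l" by (simp add: g_def l_def)
    show "g w \<in> ?C"
      using w by (simp add: g O_set_def weight_block_add_full_block[OF l])
    have "adj (w + full_block l) (full_block m) \<longleftrightarrow> adj w (full_block m)" for m
      using blocks.isotropic[of "full_block l" "full_block m"] by simp
    then show "g (g w) = w"
      unfolding g unfolding g_def l_def[symmetric] by (simp add: l_def[symmetric])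
    show "adj x (g w) \<noteq> adj x w"
      using * by (simp add: g mem_weight_one_cell)
  qed
  with C y * show ?flip unfolding gm_flip_Sp_iff by auto
qed

lemma nonzero_min_weight_one_cell:
  assumes "3 \<le> CARD('n)"
  shows "nonzero_min_common_neighbors (gm_switch (Sp :: 'n::finite symp_vec pair_pre_digraph)
    O_partition (O_set 0 CARD('n) 0)) = 2 ^ (CARD('n) - 2)"
proof -
  let ?D = "O_set 0 CARD('n) 0 :: 'n symp_vec set"
  interpret coset_switch "range full_block" ?D "gm_switch Sp O_partition ?D"
  proof
    show "?D \<inter> vec.span (range full_block) = {}"
      by (auto simp: span_full_blocks mem_weight_one_cell)
    show "x + v \<in> ?D" if "x \<in> ?D" "v \<in> vec.span (range full_block)" for x v
      using that by (simp add: span_full_blocks mem_weight_one_cell)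
  qed (auto simp: pverts_gm_switch_Sp parcs_gm_switch_Sp gm_flip_weight_one_cell)
  have "2 * CARD('n) - CARD('n) - 2 = CARD('n) - 2" by simp
  then show ?thesis
    using nonzero_min_common_neighbors_single_coset[OF weight_one_cell_eq, of "full_block undefined"] assms
    by (simp add: card_range_full_block)
qed

lemma pair_wf_digraph_Sp: "pair_wf_digraph (Sp :: 'n::finite symp_vec pair_pre_digraph)"
proof -
  interpret pair_graph "Sp :: 'n symp_vec pair_pre_digraph" by (rule pair_graph_Sp)
  show ?thesis by (rule pair_wf_digraph_axioms)
qed

theorem theorem5p10:
  fixes v1 v2 v3 v4 :: "'n::finite symp_vec"
    and S T :: "'n symp_vec set"
    and X XO XS XS4 XS0 :: "'n symp_vec pair_pre_digraph"
  assumes nu: "CARD('n) \<ge> 3"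
    and S_sub: "S \<subseteq> pverts Sp"
    and S_card: "card S = 4"
    and S_eq: "S = {v1, v2, v3, v4}"
    and indep: "vec.independent {v1, v2, v3}"
    and isotropic: "\<forall>x\<in>{v1, v2, v3}. \<forall>y\<in>{v1, v2, v3}. symp_form x y = 0"
    and v4_eq: "v4 = v1 + v2 + v3"
    and T_eq: "T = {v1 + v2, v2 + v3, v3 + v1}"
    and X_eq: "X = Sp"
    and XO_eq: "XO = gm_switch X O_partition (O_set 0 CARD('n) 0)"
    and XS_eq: "XS = gm_switch X (S_partition S T) S"
    and XS4_eq: "XS4 = gm_switch X (S_partition S T) (S_level S 4)"
    and XS0_eq: "XS0 = gm_switch X (S_partition S T) (S_level S 0 - (S \<union> T))"
  shows "nonzero_min_common_neighbors X = 2 ^ (2 * CARD('n) - 3)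
    \<and> nonzero_min_common_neighbors XS = 1
    \<and> nonzero_min_common_neighbors XO = 2 ^ (CARD('n) - 2)
    \<and> nonzero_min_common_neighbors XS4 = 2 ^ (2 * CARD('n) - 5)
    \<and> (CARD('n) \<ge> 4 \<longrightarrow> nonzero_min_common_neighbors XS0 = 2 ^ (2 * CARD('n) - 5) - 2)
    \<and> sorted_wrt (\<lambda>G H. \<not> graph_iso G H) [X, XO, XS]
    \<and> sorted_wrt (\<lambda>G H. \<not> graph_iso G H) [X, XS, XS4]
    \<and> (CARD('n) \<ge> 4 \<longrightarrow> sorted_wrt (\<lambda>G H. \<not> graph_iso G H) [X, XO, XS, XS4, XS0])"
proof -
  let ?\<mu> = "nonzero_min_common_neighbors :: 'n symp_vec pair_pre_digraph \<Rightarrow> nat"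
  interpret Q: isotropic_quadruple v1 v2 v3
    by unfold_locales (use indep isotropic S_card in \<open>auto simp: adj_def S_eq v4_eq\<close>)
  have S: "S = Q.S" by (simp add: S_eq v4_eq)
  have S0: "S_level S 0 - (S \<union> T) = Q.W_perp - Q.W"
    unfolding S T_eq Q.S_level_0 Q.span_eq by blast
  have X: "?\<mu> X = 2 ^ (2 * CARD('n) - 3)"
    unfolding X_eq by (rule nonzero_min_common_neighbors_Sp) (use nu in simp)
  have XS: "?\<mu> XS = 1"
    unfolding XS_eq X_eq T_eq S by (rule Q.nonzero_min_S)
  have XO: "?\<mu> XO = 2 ^ (CARD('n) - 2)"
    unfolding XO_eq X_eq by (rule nonzero_min_weight_one_cell[OF nu])
  have XS4: "?\<mu> XS4 = 2 ^ (2 * CARD('n) - 5)"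
    unfolding XS4_eq X_eq T_eq S Q.S_level_4 by (rule Q.nonzero_min_S4)
  have XS0: "?\<mu> XS0 = 2 ^ (2 * CARD('n) - 5) - 2" if "CARD('n) \<ge> 4"
    unfolding XS0_eq S0 unfolding X_eq T_eq S by (rule Q.nonzero_min_S0[OF that])
  have wf: "pair_wf_digraph G" if "G \<in> {X, XO, XS, XS4, XS0}" for G
    using that pair_wf_digraph_Sp pair_wf_digraph_gm_switch
    by (auto simp: X_eq XO_eq XS_eq XS4_eq XS0_eq)
  have noniso: "sorted_wrt (\<lambda>G H. \<not> graph_iso G H) Gs"
    if "sorted_wrt (\<lambda>G H. ?\<mu> G \<noteq> ?\<mu> H) Gs" "set Gs \<subseteq> {X, XO, XS, XS4, XS0}" for Gs
    using that(1)
  proof (rule sorted_wrt_mono_rel[rotated])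
    fix G H assume "G \<in> set Gs" "H \<in> set Gs" "?\<mu> G \<noteq> ?\<mu> H"
    then show "\<not> graph_iso G H"
      using nonzero_min_common_neighbors_iso[OF wf wf, of G H] that(2) by blast
  qed
  have pow: "(2::nat) ^ a < 2 ^ b" if "a < b" for a b using that by simp
  have XXO: "?\<mu> XO < ?\<mu> X" unfolding X XO by (rule pow) (use nu in simp)
  have XXS: "?\<mu> XS < ?\<mu> X" unfolding X XS using nu by (intro one_less_power) simp_all
  have XOXS: "?\<mu> XS < ?\<mu> XO" unfolding XO XS using nu by (intro one_less_power) simp_all
  have XXS4: "?\<mu> XS4 < ?\<mu> X" unfolding X XS4 by (rule pow) (use nu in simp)
  have XSXS4: "?\<mu> XS < ?\<mu> XS4" unfolding XS XS4 using nu by (intro one_less_power) simp_all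
  \<comment> \<open>subtracting two from a power of two that is at least twice as large as \<open>2\<^bsup>\<nu>-2\<^esup> \<ge> 4\<close> leaves more
    than \<open>2\<^bsup>\<nu>-2\<^esup>\<close>\<close>
  have XS0_between: "?\<mu> XO < ?\<mu> XS0 \<and> ?\<mu> XS0 < ?\<mu> XS4" if "CARD('n) \<ge> 4"
  proof -
    have "2 ^ (Suc (CARD('n) - 2)) \<le> (2::nat) ^ (2 * CARD('n) - 5)"
      "2 ^ 2 \<le> (2::nat) ^ (CARD('n) - 2)"
      by (rule power_increasing; use that in simp)+
    then show ?thesis unfolding XO XS0[OF that] XS4 by simp
  qed
  have 1: "sorted_wrt (\<lambda>G H. \<not> graph_iso G H) [X, XO, XS]"
    by (rule noniso) (use XXO XXS XOXS in simp_all)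
  have 2: "sorted_wrt (\<lambda>G H. \<not> graph_iso G H) [X, XS, XS4]"
    by (rule noniso) (use XXS XXS4 XSXS4 in simp_all)
  have 3: "sorted_wrt (\<lambda>G H. \<not> graph_iso G H) [X, XO, XS, XS4, XS0]" if "CARD('n) \<ge> 4"
    by (rule noniso) (use XXO XXS XOXS XXS4 XSXS4 XS0_between[OF that] in simp_all)
  from X XS XO XS4 XS0 1 2 3 show ?thesis by blast
qed

end
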